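(* Consider noisy GMM for the quadratic function $f$ with Gaussian gradient noise as described in the context, with parameters $(\alpha,\beta,\gamma)\in\mathcal{S}_q$, and let $\zeta\in(0,1)$ be a confidence level. Then the entropic value at risk of the noisy GMM iterations at stationarity satisfies $$\mathrm{EV@R}_{1-\zeta}[f(x_\infty)-f(x_* )]\le \bar E^q_{1-\zeta}(\alpha,\beta,\gamma):=\frac{\sigma^2}{2\theta_0\bar u}\left[-d\log(1-\theta_0)+2\log(1/\zeta)\right],$$ where $\theta_0=\frac{\log(1/\zeta)}{d}\left[\sqrt{1+\frac{2d}{\log(1/\zeta)}}-1\right]<1$, $\bar u=\min_{i\in\{1,\dots,d\}}u_i$, and $x_\infty$ is a random variable distributed according to the stationary distribution of the iterates $x_k$.
   Context: Let $0<\mu<L$ and let $f(x)=\frac12x^\top Qx+p^\top x+r$ on $\mathbb{R}^d$, where $Q$ is a symmetric matrix with eigenvalues $0<\mu=\lambda_1(Q)\le\dots\le\lambda_d(Q)=L$, $p\in\mathbb{R}^d$, $r\in\mathbb{R}$; $x_*$ is the unique minimizer of $f$. The noisy generalized momentum method (GMM) with parameters $\alpha>0$, $\beta,\gamma\ge0$ and deterministic initialization $x_0,x_{-1}\in\mathbb{R}^d$ is $$x_{k+1}=(1+\beta)x_k-\beta x_{k-1}-\alpha\left(\nabla f(y_k)+w_{k+1}\right),\qquad y_k=(1+\gamma)x_k-\gamma x_{k-1},\qquad k\ge 0.$$ Noise assumption: for each $k$, $w_{k+1}\sim\mathcal{N}(0,\sigma^2I_d)$ for some $\sigma>0$, and $w_{k+1}$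 is independent of the $\sigma$-algebra $\mathcal{F}_k$ generated by $x_0,\dots,x_k$. Let $A_Q=\begin{bmatrix}(1+\beta)I_d-\alpha(1+\gamma)Q & -(\beta I_d-\alpha\gamma Q)\\ I_d&0_d\end{bmatrix}$, with spectral radius $\rho(A_Q)$. The stable set is $\mathcal{S}_q=\{(\alpha,\beta,\gamma): \alpha>0,\ \beta,\gamma\ge0,\ \rho(A_Q)<1\}$. For parameters in $\mathcal{S}_q$ the distribution of $x_k$ converges to a (Gaussian) stationary distribution, and $x_\infty$ denotes a random variable with that law. For $i=1,\dots,d$: $c_i=(1+\beta)-\alpha(1+\gamma)\lambda_i(Q)$, $d_i=-(\beta-\alpha\gamma\lambda_i(Q))$, $u_i=\frac{(1+d_i)[(1-d_i)^2-c_i^2]}{\lambda_i(Q)(1-d_i)\alpha^2}$. For $\theta>0$: $r_{k,\sigma^2}(\theta)=\frac{2\sigma^2}{\theta}\log\mathbb{E}\left[e^{\frac{\theta}{2\sigma^2}(f(x_k)-f(x_* ))}\right]$ (possibly $+\infty$) and $r_{\sigma^2}(\theta)=\limsup_{k\to\infty}r_{k,\sigma^2}(\theta)$; in the stationary setting $r_{\sigma^2}(\theta)=\frac{2\sigma^2}{\theta}\log\mathbb{E}[e^{\frac{\theta}{2\sigma^2}(f(x_\infty)-f(x_* ))}]$. The entropic value at risk is $$\mathrm{EV@R}_{1-\zeta}[f(x_\infty)-f(x_* )]=\inf_{\theta>0}\left\{r_{\sigma^2}(\theta)+\frac{2\sigma^2}{\theta}\log\frac1\zeta\right\}.$$ 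*)

theory Defs
  imports "HOL-Probability.Probability"
begin

definition quad_fun :: "real^'n^'n \<Rightarrow> real^'n \<Rightarrow> real \<Rightarrow> real^'n \<Rightarrow> real" where
  "quad_fun Q p r x = 1/2 * (x \<bullet> (Q *v x)) + p \<bullet> x + r"

definition grad :: "('a::real_inner \<Rightarrow> real) \<Rightarrow> 'a \<Rightarrow> 'a" where
  "grad f x = (THE D. GDERIV f x :> D)"

text \<open>The eigenvalues of \<open>Q\<close>, counted with algebraic multiplicity and listed in nondecreasing
  order, are \<open>lam 1, \<dots>, lam d\<close> with \<open>d = CARD('n)\<close>; values of \<open>lam\<close> outside
  \<open>{1..d}\<close> are irrelevant. Note that \<open>mat t\<close> is \<open>t\<close> times the identity matrix.\<close>

definition ordered_eigenvalues :: "real^'n^'n \<Rightarrow> (nat \<Rightarrow> real) \<Rightarrow> bool" where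
  "ordered_eigenvalues Q lam \<longleftrightarrow>
     mono_on {1..CARD('n)} lam \<and> (\<forall>t. det (mat t - Q) = (\<Prod>i\<in>{1..CARD('n)}. t - lam i))"

text \<open>Complex eigenvalues of a real square matrix.\<close>

definition complex_eigenvalue :: "real^'m^'m \<Rightarrow> complex \<Rightarrow> bool" where
  "complex_eigenvalue A z \<longleftrightarrow> (\<exists>v::complex^'m. v \<noteq> 0 \<and> map_matrix complex_of_real A *v v = z *s v)"

definition spectral_radius :: "real^'m^'m \<Rightarrow> real" where
  "spectral_radius A = Max {cmod z | z. complex_eigenvalue A z}"

definition block_matrix ::
  "real^'n^'n \<Rightarrow> real^'n^'n \<Rightarrow> real^'n^'n \<Rightarrow> real^'n^'n \<Rightarrow> real^('n + 'n)^('n + 'n)" where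
  "block_matrix A B C D = (\<chi> i j.
     (case i of
        Inl a \<Rightarrow> (case j of Inl b \<Rightarrow> A $ a $ b | Inr b \<Rightarrow> B $ a $ b)
      | Inr a \<Rightarrow> (case j of Inl b \<Rightarrow> C $ a $ b | Inr b \<Rightarrow> D $ a $ b)))"

definition gmm_matrix :: "real^'n^'n \<Rightarrow> real \<Rightarrow> real \<Rightarrow> real \<Rightarrow> real^('n + 'n)^('n + 'n)" where
  "gmm_matrix Q \<alpha> \<beta> \<gamma> =
     block_matrix ((1 + \<beta>) *\<^sub>R mat 1 - (\<alpha> * (1 + \<gamma>)) *\<^sub>R Q) (- (\<beta> *\<^sub>R mat 1 - (\<alpha> * \<gamma>) *\<^sub>R Q))
                  (mat 1) 0"

definition stable_set :: "real^'n^'n \<Rightarrow> (real \<times> real \<times> real) set" where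
  "stable_set Q =
     {(\<alpha>, \<beta>, \<gamma>). \<alpha> > 0 \<and> \<beta> \<ge> 0 \<and> \<gamma> \<ge> 0 \<and> spectral_radius (gmm_matrix Q \<alpha> \<beta> \<gamma>) < 1}"

text \<open>The iterates are indexed by integers so that \<open>x (-1)\<close> is available; only indices
  \<open>\<ge> -1\<close> are constrained. The noise \<open>w 0\<close> is never used.\<close>

definition noisy_gmm ::
  "'a measure \<Rightarrow> (real^'n \<Rightarrow> real) \<Rightarrow> real \<Rightarrow> real \<Rightarrow> real \<Rightarrow> real^'n \<Rightarrow> real^'n
     \<Rightarrow> (nat \<Rightarrow> 'a \<Rightarrow> real^'n) \<Rightarrow> (int \<Rightarrow> 'a \<Rightarrow> real^'n) \<Rightarrow> bool" where
  "noisy_gmm M f \<alpha> \<beta> \<gamma> x0 xm1 w x \<longleftrightarrow>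
     (\<forall>\<omega>\<in>space M. x 0 \<omega> = x0 \<and> x (- 1) \<omega> = xm1 \<and>
       (\<forall>k::nat.
          (let y = (1 + \<gamma>) *\<^sub>R x (int k) \<omega> - \<gamma> *\<^sub>R x (int k - 1) \<omega>
           in x (int k + 1) \<omega> = (1 + \<beta>) *\<^sub>R x (int k) \<omega> - \<beta> *\<^sub>R x (int k - 1) \<omega>
                                - \<alpha> *\<^sub>R (grad f y + w (k + 1) \<omega>))))"

text \<open>Lebesgue density of the normal distribution with mean \<open>0\<close> and covariance
  \<open>\<sigma>\<^sup>2 I\<close>. The second argument of \<open>normal_density\<close> is the standard deviation.\<close>

definition isotropic_normal_density :: "real \<Rightarrow> real^'n \<Rightarrow> real" where
  "isotropic_normal_density \<sigma> v = (\<Prod>i\<in>UNIV. normal_density 0 \<sigma> (v $ i))"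

text \<open>The events of the sigma-algebra generated by \<open>x 0, \<dots>, x k\<close>.\<close>

definition history :: "'a measure \<Rightarrow> (int \<Rightarrow> 'a \<Rightarrow> real^'n) \<Rightarrow> nat \<Rightarrow> 'a set set" where
  "history M x k =
     sigma_sets (space M) (\<Union>j\<in>{0..int k}. {x j -` B \<inter> space M | B. B \<in> sets borel})"

definition gaussian_noise ::
  "'a measure \<Rightarrow> real \<Rightarrow> (nat \<Rightarrow> 'a \<Rightarrow> real^'n) \<Rightarrow> (int \<Rightarrow> 'a \<Rightarrow> real^'n) \<Rightarrow> bool" where
  "gaussian_noise M \<sigma> w x \<longleftrightarrow>
     (\<forall>k::nat. distributed M lborel (w (k + 1)) (\<lambda>v. ennreal (isotropic_normal_density \<sigma> v)) \<and>
       prob_space.indep_set M {w (k + 1) -` B \<inter> space M | B. B \<in> sets borel} (history M x k))"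

text \<open>Convergence in distribution to \<open>\<nu>\<close>; the theory \<open>Weak_Convergence\<close> only treats
  measures on the real line.\<close>

definition converges_weakly :: "(nat \<Rightarrow> 'b::topological_space measure) \<Rightarrow> 'b measure \<Rightarrow> bool" where
  "converges_weakly \<mu> \<nu> \<longleftrightarrow>
     (\<forall>g::'b \<Rightarrow> real. continuous_on UNIV g \<longrightarrow> bounded (range g) \<longrightarrow>
        (\<lambda>k. integral\<^sup>L (\<mu> k) g) \<longlonglongrightarrow> integral\<^sup>L \<nu> g)"

text \<open>The stationary distribution is the limit in distribution of the iterates; it is unique because
  weak limits of probability measures are.\<close>

definition stationary_law ::
  "'a measure \<Rightarrow> (int \<Rightarrow> 'a \<Rightarrow> real^'n) \<Rightarrow> (real^'n) measure \<Rightarrow> bool" where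
  "stationary_law M x \<nu> \<longleftrightarrow>
     prob_space \<nu> \<and> sets \<nu> = sets borel \<and> converges_weakly (\<lambda>k. distr M borel (x (int k))) \<nu>"

definition ln_ennreal :: "ennreal \<Rightarrow> ereal" where
  "ln_ennreal e = (if e = \<top> then \<infinity> else if e = 0 then - \<infinity> else ereal (ln (enn2real e)))"

text \<open>The finite-horizon quantities and their stationary counterpart are all instances of this
  one; an infinite exponential moment gives the value \<open>\<infinity>\<close>.\<close>

definition risk_cost :: "'b measure \<Rightarrow> real \<Rightarrow> ('b \<Rightarrow> real) \<Rightarrow> real \<Rightarrow> ereal" where
  "risk_cost N \<sigma> Z \<theta> =
     ereal (2 * \<sigma>\<^sup>2 / \<theta>) *
     ln_ennreal (\<integral>\<^sup>+\<omega>. ennreal (exp (\<theta> / (2 * \<sigma>\<^sup>2) * Z \<omega>)) \<partial>N)"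

text \<open>\<open>EVaR N \<sigma> \<zeta> Z\<close> is the entropic value at risk of \<open>Z\<close> at level \<open>1 - \<zeta>\<close>.\<close>

definition EVaR :: "'b measure \<Rightarrow> real \<Rightarrow> real \<Rightarrow> ('b \<Rightarrow> real) \<Rightarrow> ereal" where
  "EVaR N \<sigma> \<zeta> Z =
     (INF \<theta>\<in>{0<..}. risk_cost N \<sigma> Z \<theta> + ereal (2 * \<sigma>\<^sup>2 / \<theta> * ln (1 / \<zeta>)))"

definition gmm_c :: "real \<Rightarrow> real \<Rightarrow> real \<Rightarrow> real \<Rightarrow> real" where
  "gmm_c \<alpha> \<beta> \<gamma> l = (1 + \<beta>) - \<alpha> * (1 + \<gamma>) * l"

definition gmm_d :: "real \<Rightarrow> real \<Rightarrow> real \<Rightarrow> real \<Rightarrow> real" where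
  "gmm_d \<alpha> \<beta> \<gamma> l = - (\<beta> - \<alpha> * \<gamma> * l)"

definition gmm_u :: "real \<Rightarrow> real \<Rightarrow> real \<Rightarrow> real \<Rightarrow> real" where
  "gmm_u \<alpha> \<beta> \<gamma> l =
     (1 + gmm_d \<alpha> \<beta> \<gamma> l) * ((1 - gmm_d \<alpha> \<beta> \<gamma> l)\<^sup>2 - (gmm_c \<alpha> \<beta> \<gamma> l)\<^sup>2)
     / (l * (1 - gmm_d \<alpha> \<beta> \<gamma> l) * \<alpha>\<^sup>2)"

definition theta0 :: "real \<Rightarrow> nat \<Rightarrow> real" where
  "theta0 \<zeta> d = ln (1 / \<zeta>) / real d * (sqrt (1 + 2 * real d / ln (1 / \<zeta>)) - 1)"

definition evar_bound :: "nat \<Rightarrow> real \<Rightarrow> real \<Rightarrow> real \<Rightarrow> real" where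
  "evar_bound d \<sigma> \<zeta> u =
     \<sigma>\<^sup>2 / (2 * theta0 \<zeta> d * u) * (- real d * ln (1 - theta0 \<zeta> d) + 2 * ln (1 / \<zeta>))"

end

theory Submission
  imports Defs
begin

text \<open>The proof rests on decoupling. The matrix \<open>Q\<close> has an orthonormal eigenbasis, and in the direction
of an eigenvector with eigenvalue \<open>l\<close> the centred iterates \<open>z\<close> follow the scalar autoregression
\<open>z (k + 1) = c z k + d z (k - 1) - \<alpha> \<eta>\<close>, where \<open>c\<close> and \<open>d\<close> are \<open>gmm_c\<close> and \<open>gmm_d\<close> at \<open>l\<close> and
\<open>\<eta>\<close> is normal with variance \<open>\<sigma>\<^sup>2\<close>. Its stationary variance is \<open>v = \<sigma>\<^sup>2 / (l u)\<close> with \<open>u\<close> the value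
of \<open>gmm_u\<close> at \<open>l\<close>. The excess cost is \<open>\<Sum> l z\<^sup>2 / 2\<close>, so with the exponent
\<open>\<theta> = 2 ubar theta0\<close>, where \<open>ubar\<close> is the minimum of the values of \<open>gmm_u\<close>, each direction
contributes at most the moment \<open>E exp (theta0 g\<^sup>2 / 2) = 1 / sqrt (1 - theta0)\<close> of a standard normal
\<open>g\<close>. The product over all directions, inserted at this single \<open>\<theta>\<close> into the infimum that
defines the entropic value at risk, is the asserted bound.

The bound on the quadratic moment is derived from linear exponents. The exponential moment of
\<open>\<Sum> (s z k + t z (k - 1))\<close> is bounded by induction on \<open>k\<close>, because
conditioning on the past replaces \<open>(s, t)\<close> by \<open>(c s + t, d s)\<close> and produces the factor
\<open>exp (\<alpha>\<^sup>2 \<sigma>\<^sup>2 s\<^sup>2 / 2)\<close> in each direction (\<open>linear_exponential_moment_le\<close>). The quadratic form \<open>ar2_pair_variance\<close>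
decreases by exactly \<open>s\<^sup>2\<close> along this map and thus bounds the accumulated noise; the same identity
makes the noise-free trajectory vanish in the limit (\<open>noise_free_recursion_tendsto_0\<close>). Weak
convergence carries the bound over to the stationary law (\<open>stationary_linear_exponential_moment_le\<close>).
Quadratic exponents are reached by averaging linear ones over an auxiliary Gaussian vector
(\<open>subgaussian_quadratic_exponential_moment\<close>).

Stability enters through \<open>stable_set_imp_schur_stable\<close>: every root of \<open>z\<^sup>2 = c z + d\<close> is an
eigenvalue of the block matrix, and a spectral radius below one forces \<open>\<bar>d\<bar> < 1\<close> and
\<open>\<bar>c\<bar> < 1 - d\<close>, which is what makes \<open>ar2_pair_variance\<close> positive semidefinite.\<close>

section \<open>Orthonormal eigenbases of self-adjoint maps\<close>

lemma quadratic_bound_imp_linear_zero: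
  fixes a C :: real
  assumes "\<And>t. 2 * t * a \<le> t\<^sup>2 * C"
  shows "a = 0"
proof (rule ccontr)
  assume "a \<noteq> 0"
  \<comment> \<open>A step of the sign of \<open>a\<close>, so short that the quadratic term cannot compensate the linear one.\<close>
  define t where "t = a / (\<bar>C\<bar> + 1)"
  have "2 * t * a \<le> t\<^sup>2 * C" by (rule assms)
  also have "\<dots> \<le> t\<^sup>2 * (\<bar>C\<bar> + 1)"
    by (intro mult_left_mono) auto
  also have "\<dots> = t * a"
    by (simp add: t_def power2_eq_square)
  finally have "t * a \<le> 0" by (simp add: mult.commute)
  moreover have "t * a > 0"
    using \<open>a \<noteq> 0\<close> by (simp add: t_def power2_eq_square[symmetric] zero_less_divide_iff)
  ultimately show False by simp
qed

text \<open>
A maximizer of the Rayleigh quotient on the unit sphere of the invariant subspace is an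
eigenvector, since the first variation of the quotient vanishes there.
\<close>

lemma self_adjoint_eigenvector:
  fixes f :: "'v::euclidean_space \<Rightarrow> 'v"
  assumes f: "linear f" and sa: "\<And>x y. f x \<bullet> y = x \<bullet> f y"
    and S: "subspace S" and inv: "\<And>x. x \<in> S \<Longrightarrow> f x \<in> S" and nz: "S \<noteq> {0}"
  obtains e m where "e \<in> S" "norm e = 1" "f e = m *\<^sub>R e"
proof -
  let ?K = "sphere 0 1 \<inter> S"
  have "compact ?K"
    using closed_subspace[OF S] by (intro compact_Int_closed) auto
  moreover have "?K \<noteq> {}"
  proof -
    obtain x where "x \<in> S" "x \<noteq> 0"
      using nz subspace_0[OF S] by blast
    then have "x /\<^sub>R norm x \<in> ?K"
      using subspace_scale[OF S] by auto
    then show ?thesis by blast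
  qed
  moreover have "continuous_on ?K (\<lambda>x. x \<bullet> f x)"
    using f by (intro continuous_intros linear_continuous_on) (simp add: linear_conv_bounded_linear)
  ultimately obtain e where e: "e \<in> ?K" and max: "\<And>x. x \<in> ?K \<Longrightarrow> x \<bullet> f x \<le> e \<bullet> f e"
    using continuous_attains_sup[of ?K "\<lambda>x. x \<bullet> f x"] by blast
  define m where "m = e \<bullet> f e"
  have ee: "e \<bullet> e = 1" "e \<in> S"
    using e by (auto simp: norm_eq_1)
  have ray: "x \<bullet> f x \<le> m * (x \<bullet> x)" if "x \<in> S" for x
  proof (cases "x = 0")
    case True
    then show ?thesis using linear_0[OF f] by simp
  next
    case False
    have "x /\<^sub>R norm x \<in> ?K"
      using that False subspace_scale[OF S] by auto
    from max[OF this] have "(x \<bullet> f x) / (norm x)\<^sup>2 \<le> m"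
      by (simp add: m_def linear_scale[OF f] power2_eq_square field_simps)
    then show ?thesis
      using False by (simp add: divide_simps power2_norm_eq_inner)
  qed
  \<comment> \<open>Perturbing the maximizer in the direction of the residual itself shows that the residual is
    orthogonal to itself.\<close>
  define y where "y = f e - m *\<^sub>R e"
  have y: "y \<in> S"
    unfolding y_def using ee inv S by (auto intro: subspace_diff subspace_scale)
  have "2 * t * (y \<bullet> y) \<le> t\<^sup>2 * (m * (y \<bullet> y) - y \<bullet> f y)" for t
  proof -
    have "(e + t *\<^sub>R y) \<bullet> f (e + t *\<^sub>R y) \<le> m * ((e + t *\<^sub>R y) \<bullet> (e + t *\<^sub>R y))"
      by (rule ray) (use ee y S in \<open>auto intro: subspace_add subspace_scale\<close>)
    then have "m + 2 * t * (y \<bullet> f e) + t\<^sup>2 * (y \<bullet> f y) \<le> m * (1 + 2 * t * (y \<bullet> e) + t\<^sup>2 * (y \<bullet> y))"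
      using sa[of e y] ee
      by (simp add: linear_add[OF f] linear_scale[OF f] inner_add_left inner_add_right m_def
          power2_eq_square inner_commute algebra_simps)
    moreover have "y \<bullet> f e = y \<bullet> y + m * (y \<bullet> e)"
      by (simp add: y_def inner_diff_right)
    ultimately show ?thesis by (simp add: algebra_simps)
  qed
  then have "y \<bullet> y = 0"
    by (rule quadratic_bound_imp_linear_zero)
  then have "f e = m *\<^sub>R e" by (simp add: y_def)
  with ee that show thesis by (simp add: norm_eq_1)
qed

definition orthonormal_set :: "'v::real_inner set \<Rightarrow> bool" where
  "orthonormal_set B \<longleftrightarrow> (\<forall>a\<in>B. \<forall>b\<in>B. a \<bullet> b = (if a = b then 1 else 0))"

text \<open>
Splitting off one eigenvector leaves its orthogonal complement invariant, so induction on the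
dimension applies; this is why the statement is about invariant subspaces.
\<close>

lemma self_adjoint_eigenbasis:
  fixes f :: "'v::euclidean_space \<Rightarrow> 'v"
  assumes f: "linear f" and sa: "\<And>x y. f x \<bullet> y = x \<bullet> f y"
    and S: "subspace S" and inv: "\<And>x. x \<in> S \<Longrightarrow> f x \<in> S"
  shows "\<exists>B l. finite B \<and> orthonormal_set B \<and> span B = S \<and> (\<forall>b\<in>B. f b = l b *\<^sub>R b)"
  using S inv
proof (induction "dim S" arbitrary: S rule: less_induct)
  case less
  show ?case
  proof (cases "S = {0}")
    case True
    then show ?thesis
      by (intro exI[of _ "{}"]) (auto simp: orthonormal_set_def)
  next
    case False
    then obtain e m where e: "e \<in> S" "norm e = 1" "f e = m *\<^sub>R e"
      using self_adjoint_eigenvector[OF f sa less.prems(1,2)] by metis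
    let ?T = "{x \<in> S. x \<bullet> e = 0}"
    have ee: "e \<bullet> e = 1" using e(2) by (simp add: norm_eq_1)
    have T: "subspace ?T"
      using less.prems(1) by (auto simp: subspace_def inner_add_left)
    have "f x \<in> ?T" if "x \<in> ?T" for x
      using that less.prems(2) sa[of x e] e(3) by auto
    moreover have "dim ?T < dim S"
    proof (rule dim_psubset)
      have "e \<notin> ?T" using ee by simp
      moreover have "span ?T = ?T" "span S = S"
        using T less.prems(1) by (simp_all only: span_eq_iff)
      ultimately show "span ?T \<subset> span S" using e(1) by blast
    qed
    ultimately obtain B l where B: "finite B" "orthonormal_set B" "span B = ?T" "\<forall>b\<in>B. f b = l b *\<^sub>R b"
      using less.hyps[of ?T] T by blast
    have BT: "b \<in> S \<and> b \<bullet> e = 0" if "b \<in> B" for b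
      using span_base[OF that] B(3) by auto
    have "e \<notin> B" using BT ee by auto
    have "span (insert e B) = S"
    proof
      show "span (insert e B) \<subseteq> S"
        using BT e(1) less.prems(1) by (intro span_minimal) auto
      show "S \<subseteq> span (insert e B)"
      proof
        fix x assume "x \<in> S"
        then have "x - (x \<bullet> e) *\<^sub>R e \<in> ?T"
          using e(1) ee less.prems(1)
          by (auto simp: inner_diff_left intro: subspace_diff subspace_scale)
        then show "x \<in> span (insert e B)"
          using B(3) by (auto simp: span_insert)
      qed
    qed
    moreover have "orthonormal_set (insert e B)"
      using B(2) BT ee \<open>e \<notin> B\<close> by (auto simp: orthonormal_set_def inner_commute)
    moreover have "\<forall>b\<in>insert e B. f b = (l(e := m)) b *\<^sub>R b"
      using B(4) e(3) \<open>e \<notin> B\<close> by auto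
    ultimately show ?thesis using B(1) by blast
  qed
qed

lemma orthonormal_expansion:
  fixes B :: "'v::real_inner set"
  assumes "finite B" "orthonormal_set B" "span B = UNIV"
  shows "x = (\<Sum>b\<in>B. (x \<bullet> b) *\<^sub>R b)"
proof -
  have "x \<in> span B" using assms by simp
  then obtain u where u: "x = (\<Sum>b\<in>B. u b *\<^sub>R b)"
    using assms(1) by (auto simp: span_finite)
  have "x \<bullet> a = u a" if "a \<in> B" for a
  proof -
    have "x \<bullet> a = (\<Sum>b\<in>B. u b * (b \<bullet> a))"
      by (simp add: u inner_sum_left)
    also have "\<dots> = (\<Sum>b\<in>B. if b = a then u b else 0)"
      using assms(2) that by (intro sum.cong) (auto simp: orthonormal_set_def)
    finally show ?thesis using assms(1) that by simp
  qed
  then show ?thesis using u by simp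
qed

lemma orthonormal_norm_sum:
  fixes B :: "'v::real_inner set"
  assumes "finite B" "orthonormal_set B"
  shows "(norm (\<Sum>b\<in>B. s b *\<^sub>R b))\<^sup>2 = (\<Sum>b\<in>B. (s b)\<^sup>2)"
proof -
  have "(\<Sum>b\<in>B. s b *\<^sub>R b) \<bullet> (\<Sum>b\<in>B. s b *\<^sub>R b) = (\<Sum>a\<in>B. \<Sum>b\<in>B. s a * s b * (b \<bullet> a))"
    by (simp add: inner_sum_left inner_sum_right inner_commute mult_ac)
  also have "\<dots> = (\<Sum>a\<in>B. \<Sum>b\<in>B. if b = a then s a * s b else 0)"
    using assms by (intro sum.cong) (auto simp: orthonormal_set_def)
  finally show ?thesis
    using assms(1) by (simp add: power2_norm_eq_inner power2_eq_square[of "s _"])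
qed

lemma orthonormal_card:
  fixes B :: "'v::euclidean_space set"
  assumes "orthonormal_set B" "span B = UNIV"
  shows "card B = DIM('v)"
proof -
  have "0 \<notin> B"
    using assms(1) by (force simp: orthonormal_set_def)
  then have "independent B"
    using assms(1)
    by (intro pairwise_orthogonal_independent)
      (auto simp: pairwise_def orthogonal_def orthonormal_set_def)
  then show ?thesis
    using dim_eq_card[of B UNIV] assms(2) by (simp add: dim_UNIV)
qed

lemma symmetric_matrix_self_adjoint:
  fixes Q :: "real^'n^'n"
  assumes "transpose Q = Q"
  shows "(Q *v x) \<bullet> y = x \<bullet> (Q *v y)"
  by (metis assms dot_lmul_matrix transpose_matrix_vector)

lemma symmetric_matrix_eigenbasis:
  fixes Q :: "real^'n^'n"
  assumes "transpose Q = Q"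
  obtains B l where "finite B" "orthonormal_set B" "span B = UNIV"
    "\<And>b. b \<in> B \<Longrightarrow> Q *v b = l b *\<^sub>R b"
  using self_adjoint_eigenbasis[of "(*v) Q" UNIV] symmetric_matrix_self_adjoint[OF assms]
    matrix_vector_mul_linear[of Q] that by (metis UNIV_I subspace_UNIV)

lemma eigenvalue_iff_det_zero:
  fixes Q :: "real^'n^'n"
  shows "(\<exists>v. v \<noteq> 0 \<and> Q *v v = t *\<^sub>R v) \<longleftrightarrow> det (mat t - Q) = 0"
proof -
  have "mat t = t *\<^sub>R (mat 1 :: real^'n^'n)"
    by (simp add: mat_def vec_eq_iff)
  then have "(mat t - Q) *v v = t *\<^sub>R v - Q *v v" for v
    by (simp add: matrix_vector_mult_diff_rdistrib scaleR_matrix_vector_assoc[symmetric])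
  then have "(\<exists>v. v \<noteq> 0 \<and> Q *v v = t *\<^sub>R v) \<longleftrightarrow> \<not> (\<forall>v. (mat t - Q) *v v = 0 \<longrightarrow> v = 0)"
    by (metis right_minus_eq)
  also have "\<dots> \<longleftrightarrow> \<not> invertible (mat t - Q)"
    by (simp add: matrix_left_invertible_ker[symmetric] invertible_left_inverse)
  finally show ?thesis by (simp add: invertible_det_nz)
qed

text \<open>
The set of eigenvalues, without multiplicities, is the right object here, because each eigendirection
is later estimated by a minimum over all eigenvalues.
\<close>

lemma ordered_eigenvalues_iff:
  assumes "ordered_eigenvalues (Q :: real^'n^'n) lam"
  shows "(\<exists>v. v \<noteq> 0 \<and> Q *v v = t *\<^sub>R v) \<longleftrightarrow> t \<in> lam ` {1..CARD('n)}"
  using assms unfolding eigenvalue_iff_det_zero ordered_eigenvalues_def by auto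

section \<open>The quadratic objective\<close>

lemma quad_fun_GDERIV:
  fixes Q :: "real^'n^'n"
  assumes "transpose Q = Q"
  shows "GDERIV (quad_fun Q p r) x :> Q *v x + p"
proof -
  have "((\<lambda>x. Q *v x) has_derivative (\<lambda>h. Q *v h)) (at x)"
    by (simp add: linear_imp_has_derivative)
  then have "((\<lambda>x. 1/2 * (x \<bullet> (Q *v x)) + p \<bullet> x + r) has_derivative
      (\<lambda>h. 1/2 * (x \<bullet> (Q *v h) + h \<bullet> (Q *v x)) + p \<bullet> h)) (at x)"
    by (auto intro!: derivative_eq_intros)
  moreover have "1/2 * (x \<bullet> (Q *v h) + h \<bullet> (Q *v x)) + p \<bullet> h = h \<bullet> (Q *v x + p)" for h
    using symmetric_matrix_self_adjoint[OF assms, of x h]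
    by (simp add: inner_commute inner_add_right)
  ultimately show ?thesis
    by (simp add: gderiv_def quad_fun_def[abs_def])
qed

lemma GDERIV_imp_grad:
  assumes "GDERIV f x :> D"
  shows "grad f x = D"
  unfolding grad_def
proof (rule the_equality)
  show "GDERIV f x :> D" by (rule assms)
next
  fix E assume "GDERIV f x :> E"
  then have "(\<lambda>h. h \<bullet> E) = (\<lambda>h. h \<bullet> D)"
    using assms unfolding gderiv_def by (rule has_derivative_unique)
  then have "h \<bullet> (E - D) = 0" for h
    by (simp add: inner_diff_right fun_eq_iff)
  from this[of "E - D"] show "E = D" by simp
qed

lemma grad_quad_fun:
  fixes Q :: "real^'n^'n"
  shows "transpose Q = Q \<Longrightarrow> grad (quad_fun Q p r) x = Q *v x + p"
  by (intro GDERIV_imp_grad quad_fun_GDERIV)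

lemma quad_fun_minimizer:
  fixes Q :: "real^'n^'n"
  assumes sym: "transpose Q = Q" and min: "is_arg_min (quad_fun Q p r) (\<lambda>_. True) xstar"
  shows "p = - (Q *v xstar)"
proof -
  have "(\<lambda>h. h \<bullet> (Q *v xstar + p)) = (\<lambda>h. 0)"
    using quad_fun_GDERIV[OF sym, of p r xstar] min unfolding gderiv_def
    by (intro differential_zero_maxmin[of xstar UNIV "quad_fun Q p r"]) (auto simp: is_arg_min_linorder)
  then have "(Q *v xstar + p) \<bullet> (Q *v xstar + p) = 0" by metis
  then show ?thesis by (simp add: eq_neg_iff_add_eq_0 add.commute)
qed

lemma quad_fun_excess:
  fixes Q :: "real^'n^'n"
  assumes sym: "transpose Q = Q" and p: "p = - (Q *v xstar)"
    and B: "finite B" "orthonormal_set B" "span B = UNIV" "\<And>b. b \<in> B \<Longrightarrow> Q *v b = l b *\<^sub>R b"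
  shows "quad_fun Q p r x - quad_fun Q p r xstar = 1/2 * (\<Sum>b\<in>B. l b * ((x - xstar) \<bullet> b)\<^sup>2)"
proof -
  define y where "y = x - xstar"
  have "y \<bullet> (Q *v y) = (Q *v y) \<bullet> (\<Sum>b\<in>B. (y \<bullet> b) *\<^sub>R b)"
    using orthonormal_expansion[OF B(1-3), of y] by (simp add: inner_commute)
  also have "\<dots> = (\<Sum>b\<in>B. l b * (y \<bullet> b)\<^sup>2)"
    by (simp add: inner_sum_right symmetric_matrix_self_adjoint[OF sym] B(4) power2_eq_square mult_ac)
  finally have "y \<bullet> (Q *v y) = (\<Sum>b\<in>B. l b * (y \<bullet> b)\<^sup>2)" .
  moreover have "quad_fun Q p r x - quad_fun Q p r xstar = 1/2 * (y \<bullet> (Q *v y))"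
    using symmetric_matrix_self_adjoint[OF sym, of xstar x]
    by (simp add: quad_fun_def y_def p matrix_vector_mult_diff_distrib inner_diff_left inner_diff_right
        inner_commute algebra_simps)
  ultimately show ?thesis by (simp add: y_def)
qed

section \<open>Scalar second-order recursions\<close>

text \<open>
For stable \<open>c\<close> and \<open>d\<close>, the stationary variance of the autoregression
\<open>z (k + 1) = c z k + d z (k - 1) + \<eta>\<close> driven by noise of unit variance.
\<close>

definition ar2_variance :: "real \<Rightarrow> real \<Rightarrow> real" where
  "ar2_variance c d = (1 - d) / ((1 + d) * ((1 - d)\<^sup>2 - c\<^sup>2))"

text \<open>
The stationary variance of \<open>s z k + t z (k - 1)\<close> for the same autoregression; \<open>c / (1 - d)\<close> is the
correlation of consecutive values.
\<close>

definition ar2_pair_variance :: "real \<Rightarrow> real \<Rightarrow> real \<Rightarrow> real \<Rightarrow> real" where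
  "ar2_pair_variance c d s t = ar2_variance c d * (s\<^sup>2 + t\<^sup>2 + 2 * (c / (1 - d)) * s * t)"

text \<open>
The conditions of Schur and Jury for both roots of \<open>z\<^sup>2 = c z + d\<close> to lie in the open unit disc.
\<close>

definition schur_stable :: "real \<Rightarrow> real \<Rightarrow> bool" where
  "schur_stable c d \<longleftrightarrow> \<bar>d\<bar> < 1 \<and> \<bar>c\<bar> < 1 - d"

lemma ar2_variance_pos: "schur_stable c d \<Longrightarrow> ar2_variance c d > 0"
proof -
  assume s: "schur_stable c d"
  then have "c\<^sup>2 < (1 - d)\<^sup>2"
    by (intro power2_strict_mono) (auto simp: schur_stable_def)
  then show ?thesis
    using s by (auto simp: ar2_variance_def schur_stable_def intro!: divide_pos_pos mult_pos_pos)
qed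

lemma ar2_pair_variance_nonneg:
  assumes "schur_stable c d"
  shows "ar2_pair_variance c d s t \<ge> 0"
proof -
  let ?q = "c / (1 - d)"
  have "\<bar>?q\<bar> \<le> 1"
    using assms by (auto simp: schur_stable_def abs_divide)
  then have "?q\<^sup>2 \<le> 1"
    by (simp add: abs_square_le_1)
  then have "0 \<le> (s + ?q * t)\<^sup>2 + (1 - ?q\<^sup>2) * t\<^sup>2" by simp
  also have "\<dots> = s\<^sup>2 + t\<^sup>2 + 2 * ?q * s * t"
    by (simp add: power2_eq_square algebra_simps)
  finally show ?thesis
    using ar2_variance_pos[OF assms] by (simp add: ar2_pair_variance_def)
qed

text \<open>
One step of the recursion splits the variance of \<open>s z (k + 1) + t z k\<close> into the part \<open>s\<^sup>2\<close> of the
newest noise and the variance that stems from the past, where the coefficients are those obtained by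
substituting the recursion.
\<close>

lemma ar2_pair_variance_step:
  assumes "schur_stable c d"
  shows "ar2_pair_variance c d s t = s\<^sup>2 + ar2_pair_variance c d (c * s + t) (d * s)"
proof -
  have "c\<^sup>2 < (1 - d)\<^sup>2"
    using assms by (intro power2_strict_mono) (auto simp: schur_stable_def)
  then have nz: "1 - d \<noteq> 0" "1 + d \<noteq> 0" "(1 - d)\<^sup>2 - c\<^sup>2 \<noteq> 0"
    using assms by (auto simp: schur_stable_def)
  define P where "P = ar2_variance c d"
  define q where "q = c / (1 - d)"
  have c: "c = q * (1 - d)" using nz by (simp add: q_def)
  have "P * ((1 + d) * ((1 - d)\<^sup>2 - c\<^sup>2)) = 1 - d"
    using nz by (simp add: P_def ar2_variance_def)
  then have "(1 - d) * (P * ((1 + d) * (1 - d) * (1 - q\<^sup>2)) - 1) = 0"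
    unfolding c by algebra
  then have "P * ((1 + d) * (1 - d) * (1 - q\<^sup>2)) = 1"
    using nz by simp
  then show ?thesis
    unfolding ar2_pair_variance_def P_def[symmetric] q_def[symmetric] using c by algebra
qed

text \<open>
The variance form serves as a Lyapunov function: its decrements are the squares of the trajectory,
so these squares are summable.
\<close>

lemma noise_free_recursion_tendsto_0:
  fixes m :: "nat \<Rightarrow> real"
  assumes st: "schur_stable c d" and rec: "\<And>k. m (Suc (Suc k)) = c * m (Suc k) + d * m k"
  shows "m \<longlonglongrightarrow> 0"
proof -
  \<comment> \<open>The pair of \<open>m (Suc k)\<close> and \<open>d * m k\<close> evolves under the very map \<open>(s, t) \<mapsto> (c s + t, d s)\<close>
    along which the variance form decreases.\<close>
  define V where "V k = ar2_pair_variance c d (m (Suc k)) (d * m k)" for k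
  have V: "V k = (m (Suc k))\<^sup>2 + V (Suc k)" for k
    unfolding V_def rec by (subst ar2_pair_variance_step[OF st]) simp
  have "(\<Sum>k<n. (m (Suc k))\<^sup>2) = V 0 - V n" for n
  proof (induction n)
    case (Suc n)
    then show ?case using V[of n] by simp
  qed simp
  then have "(\<Sum>k<n. (m (Suc k))\<^sup>2) \<le> V 0" for n
    using ar2_pair_variance_nonneg[OF st] by (simp add: V_def)
  then have "summable (\<lambda>k. (m (Suc k))\<^sup>2)"
    by (intro summableI_nonneg_bounded) auto
  then have "(\<lambda>k. (m (Suc k))\<^sup>2) \<longlonglongrightarrow> 0"
    by (rule summable_LIMSEQ_zero)
  then have "(\<lambda>k. m (Suc k)) \<longlonglongrightarrow> 0"
    using tendsto_real_sqrt[of "\<lambda>k. (m (Suc k))\<^sup>2" 0 sequentially]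
    by (simp add: tendsto_rabs_zero_iff)
  then show ?thesis by (rule LIMSEQ_imp_Suc)
qed

text \<open>
For real roots \<open>r1\<close> and \<open>r2\<close> the claim is the positivity of \<open>(1 - r1) (1 - r2)\<close> and
\<open>(1 + r1) (1 + r2)\<close>; for a conjugate pair the squared modulus is \<open>- d\<close>, and the negative
discriminant controls \<open>c\<close>.
\<close>

lemma roots_in_disc_imp_schur_stable:
  fixes c d :: real
  assumes roots: "\<And>z::complex. z\<^sup>2 = complex_of_real c * z + complex_of_real d \<Longrightarrow> cmod z < 1"
  shows "schur_stable c d"
proof (cases "c\<^sup>2 + 4 * d \<ge> 0")
  case True
  define D where "D = sqrt (c\<^sup>2 + 4 * d)"
  have D: "D\<^sup>2 = c\<^sup>2 + 4 * d" using True by (simp add: D_def)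
  define r1 r2 where "r1 = (c + D) / 2" and "r2 = (c - D) / 2"
  have root: "\<bar>r\<bar> < 1" if "r\<^sup>2 = c * r + d" for r
    using roots[of "complex_of_real r"] that
    by (metis norm_of_real of_real_add of_real_mult of_real_power)
  have "r1\<^sup>2 = c * r1 + d" "r2\<^sup>2 = c * r2 + d"
    using D by (auto simp: r1_def r2_def power2_eq_square field_simps)
  then have r: "\<bar>r1\<bar> < 1" "\<bar>r2\<bar> < 1" by (auto intro: root)
  have cd: "c = r1 + r2" "d = - (r1 * r2)"
    using D by (auto simp: r1_def r2_def power2_eq_square field_simps)
  have "\<bar>r1\<bar> * \<bar>r2\<bar> < 1 * 1"
    using r by (intro mult_strict_mono') auto
  then have "\<bar>d\<bar> < 1" by (simp add: cd abs_mult)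
  moreover have "(1 - r1) * (1 - r2) > 0" "(1 + r1) * (1 + r2) > 0"
    using r by auto
  then have "\<bar>c\<bar> < 1 - d" unfolding cd by (auto simp: algebra_simps abs_less_iff)
  ultimately show ?thesis by (simp add: schur_stable_def)
next
  case False
  define z where "z = Complex (c / 2) (sqrt (- (c\<^sup>2 + 4 * d)) / 2)"
  have sq: "(sqrt (- (c\<^sup>2 + 4 * d)))\<^sup>2 = - (c\<^sup>2 + 4 * d)" using False by simp
  have "z\<^sup>2 = complex_of_real c * z + complex_of_real d"
    using sq by (auto simp: z_def complex_eq_iff power2_eq_square field_simps)
  then have "cmod z < 1" by (rule roots)
  then have "(cmod z)\<^sup>2 < 1" by (simp add: power_less_one_iff)
  then have d: "- d < 1"
    using sq by (simp add: z_def cmod_power2 power_divide field_simps)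
  moreover have "c\<^sup>2 < - 4 * d" using False by simp
  then have "d < 0" using zero_le_power2[of c] by linarith
  have "c\<^sup>2 < (1 - d)\<^sup>2"
  proof -
    have "(1 - d)\<^sup>2 - (- 4 * d) = (1 + d)\<^sup>2" by (simp add: power2_eq_square algebra_simps)
    then show ?thesis using \<open>c\<^sup>2 < - 4 * d\<close> zero_le_power2[of "1 + d"] by linarith
  qed
  then have "\<bar>c\<bar> < 1 - d"
    using \<open>d < 0\<close> by (intro power2_less_imp_less[of "\<bar>c\<bar>"]) auto
  ultimately show ?thesis using \<open>d < 0\<close> by (simp add: schur_stable_def)
qed

section \<open>The spectrum of the momentum matrix\<close>

lemma sum_UNIV_Plus:
  fixes g :: "'n::finite + 'm::finite \<Rightarrow> 'c::comm_monoid_add"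
  shows "sum g UNIV = (\<Sum>a\<in>UNIV. g (Inl a)) + (\<Sum>b\<in>UNIV. g (Inr b))"
  by (simp add: UNIV_Plus_UNIV[symmetric] sum.Plus del: UNIV_Plus_UNIV)

lemma gmm_matrix_mult_Inl:
  fixes Q :: "real^'n^'n" and v :: "complex^('n+'n)"
  shows "(map_matrix complex_of_real (gmm_matrix Q \<alpha> \<beta> \<gamma>) *v v) $ Inl a =
    complex_of_real (1 + \<beta>) * v $ Inl a - complex_of_real \<beta> * v $ Inr a
    - complex_of_real (\<alpha> * (1 + \<gamma>)) * (\<Sum>b\<in>UNIV. complex_of_real (Q $ a $ b) * v $ Inl b)
    + complex_of_real (\<alpha> * \<gamma>) * (\<Sum>b\<in>UNIV. complex_of_real (Q $ a $ b) * v $ Inr b)"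
proof -
  have "(\<Sum>b\<in>UNIV. complex_of_real (s * (if a = b then 1 else 0) - t * Q $ a $ b) * y b) =
     complex_of_real s * y a - complex_of_real t * (\<Sum>b\<in>UNIV. complex_of_real (Q $ a $ b) * y b)"
    for s t and y :: "'n \<Rightarrow> complex"
  proof -
    have "(\<Sum>b\<in>UNIV. complex_of_real (s * (if a = b then 1 else 0) - t * Q $ a $ b) * y b) =
      (\<Sum>b\<in>UNIV. (if a = b then complex_of_real s * y b else 0)
         - complex_of_real t * (complex_of_real (Q $ a $ b) * y b))"
      by (intro sum.cong) (auto simp: algebra_simps)
    then show ?thesis by (simp add: sum_subtractf sum_distrib_left)
  qed
  from this[of "1 + \<beta>" "\<alpha> * (1 + \<gamma>)" "\<lambda>b. v $ Inl b"] this[of "- \<beta>" "- (\<alpha> * \<gamma>)" "\<lambda>b. v $ Inr b"]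
  show ?thesis
    by (simp add: matrix_vector_mult_def gmm_matrix_def block_matrix_def sum_UNIV_Plus mat_def
        map_matrix_def algebra_simps)
qed

lemma gmm_matrix_mult_Inr:
  fixes Q :: "real^'n^'n" and v :: "complex^('n+'n)"
  shows "(map_matrix complex_of_real (gmm_matrix Q \<alpha> \<beta> \<gamma>) *v v) $ Inr a = v $ Inl a"
proof -
  have "(\<Sum>b\<in>UNIV. complex_of_real (if a = b then 1 else 0) * v $ Inl b) =
      (\<Sum>b\<in>UNIV. if a = b then v $ Inl b else 0)"
    by (intro sum.cong) auto
  then show ?thesis
    by (simp add: matrix_vector_mult_def gmm_matrix_def block_matrix_def sum_UNIV_Plus mat_def map_matrix_def)
qed

lemma eigenvector_component:
  fixes Q :: "real^'n^'n"
  assumes "Q *v e = l *\<^sub>R e"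
  shows "(\<Sum>b\<in>UNIV. Q $ a $ b * e $ b) = l * e $ a"
  using arg_cong[OF assms, of "\<lambda>v. v $ a"] by (simp add: matrix_vector_mult_def)

text \<open>
The block matrix is a companion matrix on each eigenspace of \<open>Q\<close>, so an eigenvector \<open>e\<close> of \<open>Q\<close> and
a root \<open>z\<close> give the eigenvector with blocks \<open>z e\<close> and \<open>e\<close>.
\<close>

lemma gmm_matrix_eigenvalueI:
  fixes Q :: "real^'n^'n"
  assumes e: "Q *v e = l *\<^sub>R e" "e \<noteq> 0"
    and z: "z\<^sup>2 = complex_of_real (gmm_c \<alpha> \<beta> \<gamma> l) * z + complex_of_real (gmm_d \<alpha> \<beta> \<gamma> l)"
  shows "complex_eigenvalue (gmm_matrix Q \<alpha> \<beta> \<gamma>) z"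
proof -
  define v :: "complex^('n+'n)" where
    "v = (\<chi> i. case i of Inl a \<Rightarrow> z * complex_of_real (e $ a) | Inr a \<Rightarrow> complex_of_real (e $ a))"
  have v: "v $ Inl a = z * complex_of_real (e $ a)" "v $ Inr a = complex_of_real (e $ a)" for a
    by (simp_all add: v_def)
  have "v \<noteq> 0"
    using e(2) v(2) by (metis of_real_eq_0_iff vec_eq_iff zero_index)
  moreover have Qv: "(\<Sum>b\<in>UNIV. complex_of_real (Q $ a $ b) * complex_of_real (e $ b)) =
      complex_of_real l * complex_of_real (e $ a)" for a
    using arg_cong[OF eigenvector_component[OF e(1), of a], of complex_of_real] by simp
  have Qz: "(\<Sum>b\<in>UNIV. complex_of_real (Q $ a $ b) * (z * complex_of_real (e $ b))) =
      z * (complex_of_real l * complex_of_real (e $ a))" for a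
    unfolding Qv[symmetric] by (simp add: sum_distrib_left mult_ac)
  have "(map_matrix complex_of_real (gmm_matrix Q \<alpha> \<beta> \<gamma>) *v v) $ i = (z *s v) $ i" for i
  proof (cases i)
    case (Inl a)
    have "z * (z * complex_of_real (e $ a)) = z\<^sup>2 * complex_of_real (e $ a)"
      by (simp add: power2_eq_square)
    then show ?thesis
      unfolding Inl gmm_matrix_mult_Inl v Qv Qz z
      by (simp add: v z gmm_c_def gmm_d_def algebra_simps)
  next
    case (Inr a)
    show ?thesis unfolding Inr gmm_matrix_mult_Inr by (simp add: v)
  qed
  ultimately show ?thesis
    unfolding complex_eigenvalue_def by (metis vec_eq_iff)
qed

text \<open>
Conversely, the upper block of an eigenvector is \<open>z\<close> times the lower one, and any direction of
the eigenbasis in which the lower block does not vanish yields the scalar equation. This bounds the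
spectrum by finitely many roots, without which the maximum in \<open>spectral_radius\<close> would not dominate
its elements.
\<close>

lemma gmm_matrix_eigenvalueD:
  fixes Q :: "real^'n^'n"
  assumes sym: "transpose Q = Q"
    and B: "finite B" "orthonormal_set B" "span B = UNIV" "\<And>b. b \<in> B \<Longrightarrow> Q *v b = l b *\<^sub>R b"
    and ev: "complex_eigenvalue (gmm_matrix Q \<alpha> \<beta> \<gamma>) z"
  shows "\<exists>b\<in>B. z\<^sup>2 = complex_of_real (gmm_c \<alpha> \<beta> \<gamma> (l b)) * z + complex_of_real (gmm_d \<alpha> \<beta> \<gamma> (l b))"
proof -
  obtain v where v: "v \<noteq> 0" "map_matrix complex_of_real (gmm_matrix Q \<alpha> \<beta> \<gamma>) *v v = z *s v"
    using ev by (auto simp: complex_eigenvalue_def)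
  define y where "y a = v $ Inr a" for a
  have x: "v $ Inl a = z * y a" for a
    using arg_cong[OF v(2), of "\<lambda>u. u $ Inr a"] by (simp add: gmm_matrix_mult_Inr y_def)
  define Y where "Y b = (\<Sum>a\<in>UNIV. complex_of_real (b $ a) * y a)" for b :: "real^'n"
  have "\<exists>b\<in>B. Y b \<noteq> 0"
  proof (rule ccontr)
    assume "\<not> ?thesis"
    then have Y: "Y b = 0" if "b \<in> B" for b using that by blast
    have "(\<chi> a. Re (y a)) \<bullet> b = Re (Y b)" "(\<chi> a. Im (y a)) \<bullet> b = Im (Y b)" for b
      by (simp_all add: Y_def inner_vec_def mult.commute)
    then have "(\<chi> a. Re (y a)) = 0" "(\<chi> a. Im (y a)) = 0"
      using orthonormal_expansion[OF B(1-3), of "\<chi> a. Re (y a)"]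
        orthonormal_expansion[OF B(1-3), of "\<chi> a. Im (y a)"] Y by simp_all
    then have "y a = 0" for a
      by (simp add: vec_eq_iff complex_eq_iff)
    then have "v $ i = 0" for i
      using x y_def by (cases i) auto
    then show False using v(1) by (simp add: vec_eq_iff)
  qed
  then obtain b where b: "b \<in> B" "Y b \<noteq> 0" by blast
  have QY: "(\<Sum>a\<in>UNIV. complex_of_real (b $ a) * (\<Sum>c\<in>UNIV. complex_of_real (Q $ a $ c) * y c)) =
      complex_of_real (l b) * Y b"
  proof -
    have Qs: "Q $ a $ c = Q $ c $ a" for a c
      using sym by (metis transpose_def vec_lambda_beta)
    have "(\<Sum>a\<in>UNIV. complex_of_real (b $ a) * (\<Sum>c\<in>UNIV. complex_of_real (Q $ a $ c) * y c)) =
      (\<Sum>c\<in>UNIV. \<Sum>a\<in>UNIV. complex_of_real (b $ a) * (complex_of_real (Q $ a $ c) * y c))"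
      unfolding sum_distrib_left by (rule sum.swap)
    also have "\<dots> = (\<Sum>c\<in>UNIV. complex_of_real (\<Sum>a\<in>UNIV. Q $ c $ a * b $ a) * y c)"
      by (simp add: sum_distrib_left sum_distrib_right Qs mult_ac)
    also have "\<dots> = complex_of_real (l b) * Y b"
      unfolding eigenvector_component[OF B(4)[OF b(1)]]
      by (simp add: Y_def sum_distrib_left mult_ac)
    finally show ?thesis .
  qed
  have row: "z * (z * y a) = complex_of_real (1 + \<beta>) * (z * y a) - complex_of_real \<beta> * y a
    - complex_of_real (\<alpha> * (1 + \<gamma>)) * (z * (\<Sum>b\<in>UNIV. complex_of_real (Q $ a $ b) * y b))
    + complex_of_real (\<alpha> * \<gamma>) * (\<Sum>b\<in>UNIV. complex_of_real (Q $ a $ b) * y b)" for a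
    using arg_cong[OF v(2), of "\<lambda>u. u $ Inl a"]
    by (simp add: gmm_matrix_mult_Inl x y_def[symmetric] sum_distrib_left mult_ac)
  \<comment> \<open>Summing the upper block row against \<open>b\<close> turns \<open>Q\<close> into the scalar \<open>l b\<close>.\<close>
  have "z * (z * Y b) = (\<Sum>a\<in>UNIV. complex_of_real (b $ a) * (z * (z * y a)))"
    by (simp add: Y_def sum_distrib_left mult_ac)
  also have "\<dots> = complex_of_real (1 + \<beta>) * (z * Y b) - complex_of_real \<beta> * Y b
    - complex_of_real (\<alpha> * (1 + \<gamma>)) * (z * (complex_of_real (l b) * Y b))
    + complex_of_real (\<alpha> * \<gamma>) * (complex_of_real (l b) * Y b)"
  proof -
    define S where "S a = (\<Sum>c\<in>UNIV. complex_of_real (Q $ a $ c) * y c)" for a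
    show ?thesis
      unfolding row QY[symmetric] S_def[symmetric] unfolding Y_def
      by (simp add: sum_distrib_left sum.distrib sum_subtractf algebra_simps)
  qed
  finally have "Y b * z\<^sup>2 = Y b * (complex_of_real (gmm_c \<alpha> \<beta> \<gamma> (l b)) * z + complex_of_real (gmm_d \<alpha> \<beta> \<gamma> (l b)))"
    by (simp add: gmm_c_def gmm_d_def power2_eq_square algebra_simps)
  with b show ?thesis by auto
qed

lemma finite_complex_quadratic_roots:
  "finite {z::complex. z\<^sup>2 = c * z + d}"
proof -
  have "{z. z\<^sup>2 = c * z + d} = {z. poly [:- d, - c, 1:] z = 0}"
    by (auto simp: power2_eq_square algebra_simps)
  moreover have "finite {z. poly [:- d, - c, 1:] z = 0}"
    by (rule poly_roots_finite) simp
  ultimately show ?thesis by simp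
qed

lemma stable_set_imp_schur_stable:
  fixes Q :: "real^'n^'n"
  assumes sym: "transpose Q = Q" and st: "(\<alpha>, \<beta>, \<gamma>) \<in> stable_set Q"
    and e: "Q *v e = l *\<^sub>R e" "e \<noteq> 0"
  shows "schur_stable (gmm_c \<alpha> \<beta> \<gamma> l) (gmm_d \<alpha> \<beta> \<gamma> l)"
proof (rule roots_in_disc_imp_schur_stable)
  fix z
  assume z: "z\<^sup>2 = complex_of_real (gmm_c \<alpha> \<beta> \<gamma> l) * z + complex_of_real (gmm_d \<alpha> \<beta> \<gamma> l)"
  let ?E = "{z. complex_eigenvalue (gmm_matrix Q \<alpha> \<beta> \<gamma>) z}"
  obtain B m where B: "finite B" "orthonormal_set B" "span B = UNIV" "\<And>b. b \<in> B \<Longrightarrow> Q *v b = m b *\<^sub>R b"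
    using symmetric_matrix_eigenbasis[OF sym] by metis
  have "?E \<subseteq> (\<Union>b\<in>B. {z. z\<^sup>2 = complex_of_real (gmm_c \<alpha> \<beta> \<gamma> (m b)) * z + complex_of_real (gmm_d \<alpha> \<beta> \<gamma> (m b))})"
    using gmm_matrix_eigenvalueD[OF sym B] by blast
  then have "finite ?E"
    by (rule finite_subset) (use B(1) in \<open>simp add: finite_complex_quadratic_roots\<close>)
  then have "finite (cmod ` ?E)" by simp
  then have "cmod z \<le> Max (cmod ` ?E)"
    using gmm_matrix_eigenvalueI[OF e z] by (intro Max_ge) auto
  also have "\<dots> = spectral_radius (gmm_matrix Q \<alpha> \<beta> \<gamma>)"
    unfolding spectral_radius_def by (rule arg_cong[of _ _ Max]) auto
  finally show "cmod z < 1" using st by (simp add: stable_set_def)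
qed

section \<open>Exponential moments of Gaussian vectors\<close>

lemma nn_integral_normal_density:
  "0 < s \<Longrightarrow> (\<integral>\<^sup>+x. ennreal (normal_density m s x) \<partial>lborel) = 1"
  by (subst nn_integral_eq_integral) auto

lemma normal_linear_exponential_moment:
  assumes "0 < s"
  shows "(\<integral>\<^sup>+x. ennreal (normal_density 0 s x * exp (a * x)) \<partial>lborel) = ennreal (exp (s\<^sup>2 * a\<^sup>2 / 2))"
proof -
  have "normal_density 0 s x * exp (a * x) = exp (s\<^sup>2 * a\<^sup>2 / 2) * normal_density (s\<^sup>2 * a) s x" for x
  proof -
    have "- x\<^sup>2 / (2 * s\<^sup>2) + a * x = s\<^sup>2 * a\<^sup>2 / 2 + - (x - s\<^sup>2 * a)\<^sup>2 / (2 * s\<^sup>2)"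
      using assms by (simp add: field_simps power2_eq_square)
    then have "exp (- x\<^sup>2 / (2 * s\<^sup>2)) * exp (a * x) = exp (s\<^sup>2 * a\<^sup>2 / 2) * exp (- (x - s\<^sup>2 * a)\<^sup>2 / (2 * s\<^sup>2))"
      by (simp only: exp_add[symmetric])
    then show ?thesis
      by (simp add: normal_density_def)
  qed
  then show ?thesis
    using assms by (simp add: ennreal_mult nn_integral_cmult nn_integral_normal_density)
qed

text \<open>
The integrand is a multiple of the centred normal density of variance \<open>1 / (1 - c)\<close>.
\<close>

lemma normal_quadratic_exponential_moment:
  assumes "c < 1"
  shows "(\<integral>\<^sup>+x. ennreal (std_normal_density x * exp (c * x\<^sup>2 / 2)) \<partial>lborel) = ennreal (1 / sqrt (1 - c))"
proof -
  define s where "s = 1 / sqrt (1 - c)"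
  have s: "s > 0" "s\<^sup>2 = 1 / (1 - c)" using assms by (auto simp: s_def power_divide)
  have "std_normal_density x * exp (c * x\<^sup>2 / 2) = s * normal_density 0 s x" for x
  proof -
    have "- x\<^sup>2 / 2 + c * x\<^sup>2 / 2 = - x\<^sup>2 / (2 * s\<^sup>2)"
      using assms by (simp add: s field_simps)
    then have "exp (- x\<^sup>2 / 2) * exp (c * x\<^sup>2 / 2) = exp (- x\<^sup>2 / (2 * s\<^sup>2))"
      by (simp only: exp_add[symmetric])
    moreover have "1 / sqrt (2 * pi) = s * (1 / sqrt (2 * pi * s\<^sup>2))"
      using s(1) by (simp add: real_sqrt_mult)
    ultimately show ?thesis by (simp add: normal_density_def mult.assoc)
  qed
  then show ?thesis
    using s(1) unfolding s_def[symmetric]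
    by (simp add: ennreal_mult nn_integral_cmult nn_integral_normal_density)
qed

lemma isotropic_normal_density_Basis:
  fixes v :: "real^'n"
  shows "isotropic_normal_density \<sigma> v = (\<Prod>b\<in>Basis. normal_density 0 \<sigma> (v \<bullet> b))"
proof -
  have "(Basis :: (real^'n) set) = (\<lambda>i. axis i 1) ` UNIV"
    by (auto simp: Basis_vec_def)
  moreover have "inj (\<lambda>i::'n. axis i (1::real))"
    by (auto simp: inj_on_def axis_eq_axis)
  ultimately show ?thesis
    unfolding isotropic_normal_density_def
    by (intro prod.reindex_cong[symmetric, of "\<lambda>i. axis i 1"]) (simp_all add: inner_axis)
qed

lemma isotropic_normal_exponential_moment:
  fixes a :: "real^'n"
  assumes "0 < \<sigma>"
  shows "(\<integral>\<^sup>+v. ennreal (isotropic_normal_density \<sigma> v) * ennreal (exp (a \<bullet> v)) \<partial>lborel)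
    = ennreal (exp (\<sigma>\<^sup>2 * (norm a)\<^sup>2 / 2))"
proof -
  have "ennreal (isotropic_normal_density \<sigma> v) * ennreal (exp (a \<bullet> v)) =
     (\<Prod>b\<in>Basis. ennreal (normal_density 0 \<sigma> (v \<bullet> b) * exp ((a \<bullet> b) * (v \<bullet> b))))" for v :: "real^'n"
    by (simp add: isotropic_normal_density_Basis euclidean_inner[of a v] exp_sum prod_ennreal
        prod.distrib ennreal_mult prod_nonneg)
  then have "(\<integral>\<^sup>+v. ennreal (isotropic_normal_density \<sigma> v) * ennreal (exp (a \<bullet> v)) \<partial>lborel) =
     (\<Prod>b\<in>Basis. \<integral>\<^sup>+x. ennreal (normal_density 0 \<sigma> x * exp ((a \<bullet> b) * x)) \<partial>lborel)"
    using nn_integral_lborel_prod[where f = "\<lambda>b x. ennreal (normal_density 0 \<sigma> x * exp ((a \<bullet> b) * x))"]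
    by simp
  also have "\<dots> = ennreal (exp (\<Sum>b\<in>Basis. \<sigma>\<^sup>2 * (a \<bullet> b)\<^sup>2 / 2))"
    by (simp add: normal_linear_exponential_moment[OF assms] prod_ennreal exp_sum)
  also have "(\<Sum>b\<in>Basis. \<sigma>\<^sup>2 * (a \<bullet> b)\<^sup>2 / 2) = \<sigma>\<^sup>2 * (norm a)\<^sup>2 / 2"
  proof -
    have "(norm a)\<^sup>2 = (\<Sum>b\<in>Basis. (a \<bullet> b)\<^sup>2)"
      unfolding power2_norm_eq_inner euclidean_inner[of a a] by (simp add: power2_eq_square)
    then show ?thesis by (simp add: sum_distrib_left sum_divide_distrib)
  qed
  finally show ?thesis .
qed

text \<open>
Since \<open>exp (a z\<^sup>2 / 2) = E exp (sqrt a g z)\<close> for a standard normal \<open>g\<close>, averaging over independent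
\<open>g\<close> for all coordinates turns the quadratic exponent into a linear one. After the integrals are
exchanged, the sub-Gaussian hypothesis leaves a product of one-dimensional Gaussian integrals; its
diagonal form is what decouples the coordinates.
\<close>

lemma subgaussian_quadratic_exponential_moment:
  fixes Z :: "'i \<Rightarrow> 'b \<Rightarrow> real"
  assumes N: "prob_space N" and B: "finite B"
    and Z: "\<And>b. b \<in> B \<Longrightarrow> Z b \<in> borel_measurable N"
    and sub: "\<And>s. (\<integral>\<^sup>+\<omega>. ennreal (exp (\<Sum>b\<in>B. s b * Z b \<omega>)) \<partial>N) \<le> ennreal (exp (1/2 * (\<Sum>b\<in>B. v b * (s b)\<^sup>2)))"
    and a: "\<And>b. b \<in> B \<Longrightarrow> 0 \<le> a b" "\<And>b. b \<in> B \<Longrightarrow> a b * v b \<le> q" and q: "q < 1"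
  shows "(\<integral>\<^sup>+\<omega>. ennreal (exp (1/2 * (\<Sum>b\<in>B. a b * (Z b \<omega>)\<^sup>2))) \<partial>N) \<le> ennreal ((1 / sqrt (1 - q)) ^ card B)"
proof -
  interpret N: prob_space N by fact
  define G where "G = density lborel (\<lambda>x. ennreal (std_normal_density x))"
  interpret G: prob_space G
    unfolding G_def by (rule prob_space_normal_density) simp
  have sets_G [measurable_cong]: "sets G = sets borel" by (simp add: G_def)
  interpret GG: product_prob_space "\<lambda>_::'i. G" B ..
  interpret GG: finite_product_sigma_finite "\<lambda>_::'i. G" B by standard (rule B)
  let ?P = "Pi\<^sub>M B (\<lambda>_. G)"
  interpret P: prob_space ?P by (rule prob_space_PiM) (rule G.prob_space_axioms)
  interpret NP: pair_sigma_finite N ?P ..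
  note Z[measurable]
  have comp: "(\<lambda>g. g b) \<in> borel_measurable ?P" if "b \<in> B" for b
    using measurable_component_singleton[OF that, of "\<lambda>_. G"] by (simp cong: measurable_cong_sets add: sets_G)
  have G_int: "(\<integral>\<^sup>+x. ennreal (f x) \<partial>G) = (\<integral>\<^sup>+x. ennreal (std_normal_density x * f x) \<partial>lborel)"
    if [measurable]: "f \<in> borel_measurable borel" and "\<And>x. 0 \<le> f x" for f
    using that(2) by (simp add: G_def nn_integral_density ennreal_mult)
  have linear: "ennreal (exp (1/2 * (\<Sum>b\<in>B. a b * (Z b \<omega>)\<^sup>2)))
      = (\<integral>\<^sup>+g. ennreal (exp (\<Sum>b\<in>B. sqrt (a b) * g b * Z b \<omega>)) \<partial>?P)" for \<omega>
  proof -
    have "(\<integral>\<^sup>+g. ennreal (exp (\<Sum>b\<in>B. sqrt (a b) * g b * Z b \<omega>)) \<partial>?P)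
       = (\<integral>\<^sup>+g. (\<Prod>b\<in>B. ennreal (exp ((sqrt (a b) * Z b \<omega>) * g b))) \<partial>?P)"
      using B by (simp add: exp_sum prod_ennreal mult_ac)
    also have "\<dots> = (\<Prod>b\<in>B. \<integral>\<^sup>+x. ennreal (exp ((sqrt (a b) * Z b \<omega>) * x)) \<partial>G)"
      by (rule GG.product_nn_integral_prod[OF B]) measurable
    also have "\<dots> = (\<Prod>b\<in>B. ennreal (exp (1/2 * (a b * (Z b \<omega>)\<^sup>2))))"
      using a(1) by (intro prod.cong refl)
        (simp add: G_int normal_linear_exponential_moment power_mult_distrib)
    finally show ?thesis
      using B by (simp add: exp_sum prod_ennreal sum_distrib_left)
  qed
  have "(\<integral>\<^sup>+\<omega>. ennreal (exp (1/2 * (\<Sum>b\<in>B. a b * (Z b \<omega>)\<^sup>2))) \<partial>N)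
      = (\<integral>\<^sup>+g. \<integral>\<^sup>+\<omega>. ennreal (exp (\<Sum>b\<in>B. sqrt (a b) * g b * Z b \<omega>)) \<partial>N \<partial>?P)"
    unfolding linear
  proof (rule NP.Fubini'[symmetric])
    have [measurable]: "(\<lambda>p. snd p b) \<in> borel_measurable (N \<Otimes>\<^sub>M ?P)" if "b \<in> B" for b
      by (rule measurable_compose[OF measurable_snd comp[OF that]])
    have [measurable]: "(\<lambda>p. Z b (fst p)) \<in> borel_measurable (N \<Otimes>\<^sub>M ?P)" if "b \<in> B" for b
      by (rule measurable_compose[OF measurable_fst Z[OF that]])
    have "(\<lambda>p. \<Sum>b\<in>B. sqrt (a b) * snd p b * Z b (fst p)) \<in> borel_measurable (N \<Otimes>\<^sub>M ?P)"
      by (intro borel_measurable_sum borel_measurable_times) simp_all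
    then show "(\<lambda>(\<omega>, g). ennreal (exp (\<Sum>b\<in>B. sqrt (a b) * g b * Z b \<omega>))) \<in> borel_measurable (N \<Otimes>\<^sub>M ?P)"
      unfolding case_prod_unfold by simp
  qed
  also have "\<dots> \<le> (\<integral>\<^sup>+g. (\<Prod>b\<in>B. ennreal (exp (q * (g b)\<^sup>2 / 2))) \<partial>?P)"
  proof (rule nn_integral_mono)
    fix g
    have "(\<integral>\<^sup>+\<omega>. ennreal (exp (\<Sum>b\<in>B. sqrt (a b) * g b * Z b \<omega>)) \<partial>N)
        \<le> ennreal (exp (1/2 * (\<Sum>b\<in>B. v b * (sqrt (a b) * g b)\<^sup>2)))"
      by (rule sub)
    also have "(\<Sum>b\<in>B. v b * (sqrt (a b) * g b)\<^sup>2) \<le> (\<Sum>b\<in>B. q * (g b)\<^sup>2)"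
    proof (rule sum_mono)
      fix b assume "b \<in> B"
      then show "v b * (sqrt (a b) * g b)\<^sup>2 \<le> q * (g b)\<^sup>2"
        using a[of b] mult_right_mono[OF a(2), of b "(g b)\<^sup>2"] by (simp add: power_mult_distrib mult_ac)
    qed
    then have "ennreal (exp (1/2 * (\<Sum>b\<in>B. v b * (sqrt (a b) * g b)\<^sup>2)))
        \<le> ennreal (exp (\<Sum>b\<in>B. q * (g b)\<^sup>2 / 2))"
      by (intro ennreal_leI) (simp add: sum_divide_distrib[symmetric])
    also have "\<dots> = (\<Prod>b\<in>B. ennreal (exp (q * (g b)\<^sup>2 / 2)))"
      using B by (simp add: exp_sum prod_ennreal)
    finally show "(\<integral>\<^sup>+\<omega>. ennreal (exp (\<Sum>b\<in>B. sqrt (a b) * g b * Z b \<omega>)) \<partial>N)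
        \<le> (\<Prod>b\<in>B. ennreal (exp (q * (g b)\<^sup>2 / 2)))" .
  qed
  also have "\<dots> = (\<Prod>b\<in>B. \<integral>\<^sup>+x. ennreal (exp (q * x\<^sup>2 / 2)) \<partial>G)"
    by (rule GG.product_nn_integral_prod[OF B]) measurable
  also have "\<dots> = ennreal ((1 / sqrt (1 - q)) ^ card B)"
    using q by (simp add: G_int normal_quadratic_exponential_moment ennreal_power)
  finally show ?thesis .
qed

section \<open>Linear exponential moments of the iterates\<close>

lemma (in prob_space) indep_var_nn_integral_mult:
  fixes X Y :: "'a \<Rightarrow> ennreal"
  assumes "indep_var borel X borel Y"
  shows "(\<integral>\<^sup>+\<omega>. X \<omega> * Y \<omega> \<partial>M) = (\<integral>\<^sup>+\<omega>. X \<omega> \<partial>M) * (\<integral>\<^sup>+\<omega>. Y \<omega> \<partial>M)"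
proof -
  have "(\<lambda>_. borel :: ennreal measure) = case_bool borel borel"
    by (rule ext) (simp split: bool.split)
  then have "indep_vars (\<lambda>_. borel) (case_bool X Y) UNIV"
    using assms by (simp add: indep_var_def)
  from indep_vars_nn_integral[OF finite this] show ?thesis
    by (simp add: UNIV_bool mult.commute)
qed

lemma (in prob_space) indep_var_of_indep_algebras:
  assumes ind: "indep_set (sets F) (sets G)"
    and sp: "space F = space M" "space G = space M"
    and X: "X \<in> F \<rightarrow>\<^sub>M S" and Y: "Y \<in> G \<rightarrow>\<^sub>M T"
  shows "indep_var S X T Y"
proof -
  have sub: "sets F \<subseteq> sets M" "sets G \<subseteq> sets M"
    using ind by (auto dest: indep_setD_ev1 indep_setD_ev2)
  have "random_variable S X" "random_variable T Y"
    using X Y sub sp by (auto simp: measurable_def)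
  moreover have "sigma_sets (space M) {X -` A \<inter> space M | A. A \<in> sets S} \<subseteq> sets F"
    unfolding sp(1)[symmetric] using X by (intro sets.sigma_sets_subset) (auto dest: measurable_sets)
  moreover have "sigma_sets (space M) {Y -` A \<inter> space M | A. A \<in> sets T} \<subseteq> sets G"
    unfolding sp(2)[symmetric] using Y by (intro sets.sigma_sets_subset) (auto dest: measurable_sets)
  ultimately show ?thesis
    using ind unfolding indep_var_eq indep_set_def
    by (auto intro!: indep_sets_mono_sets[OF ind[unfolded indep_set_def]] split: bool.splits)
qed

lemma history_measurable:
  fixes x :: "int \<Rightarrow> 'a \<Rightarrow> real^'n"
  assumes "j \<in> {0..int k}"
  shows "x j \<in> sigma (space M) (\<Union>j\<in>{0..int k}. {x j -` B \<inter> space M | B. B \<in> sets borel}) \<rightarrow>\<^sub>M borel"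
    (is "_ \<in> sigma _ ?F \<rightarrow>\<^sub>M _")
proof (rule measurableI)
  fix B :: "(real^'n) set" assume "B \<in> sets borel"
  then have "x j -` B \<inter> space M \<in> ?F" using assms by blast
  then show "x j -` B \<inter> space (sigma (space M) ?F) \<in> sets (sigma (space M) ?F)"
    by (subst sets_measure_of) (auto simp: space_measure_of_conv)
qed simp

text \<open>
The newest noise is independent of the two previous iterates, so the moment factorizes; the noise
factor accounts for the decrement in \<open>ar2_pair_variance_step\<close>. At index \<open>0\<close> the iterates are
deterministic, and only the nonnegativity of \<open>ar2_pair_variance\<close> makes the bound an inequality.
\<close>

lemma linear_exponential_moment_le:
  fixes x :: "int \<Rightarrow> 'a \<Rightarrow> real^'n" and B :: "(real^'n) set" and m :: "nat \<Rightarrow> real^'n \<Rightarrow> real"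
  assumes M: "prob_space M" and \<sigma>: "0 < \<sigma>" and noise: "gaussian_noise M \<sigma> w x"
    and init: "\<And>\<omega>. \<omega> \<in> space M \<Longrightarrow> x 0 \<omega> = x0" "\<And>\<omega>. \<omega> \<in> space M \<Longrightarrow> x (- 1) \<omega> = xm1"
    and B: "finite B" "orthonormal_set B"
    and rec: "\<And>k \<omega> b. \<omega> \<in> space M \<Longrightarrow> b \<in> B \<Longrightarrow>
      (x (int k + 1) \<omega> - y) \<bullet> b = c b * ((x (int k) \<omega> - y) \<bullet> b) + d b * ((x (int k - 1) \<omega> - y) \<bullet> b)
        - \<alpha> * (w (k + 1) \<omega> \<bullet> b)"
    and stable: "\<And>b. b \<in> B \<Longrightarrow> schur_stable (c b) (d b)"
    and m: "\<And>b. m 0 b = (xm1 - y) \<bullet> b" "\<And>b. m 1 b = (x0 - y) \<bullet> b"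
      "\<And>k b. m (Suc (Suc k)) b = c b * m (Suc k) b + d b * m k b"
  shows "(\<integral>\<^sup>+\<omega>. ennreal (exp (\<Sum>b\<in>B. s b * ((x (int k) \<omega> - y) \<bullet> b) + t b * ((x (int k - 1) \<omega> - y) \<bullet> b))) \<partial>M)
    \<le> ennreal (exp ((\<Sum>b\<in>B. s b * m (Suc k) b + t b * m k b)
          + \<alpha>\<^sup>2 * \<sigma>\<^sup>2 / 2 * (\<Sum>b\<in>B. ar2_pair_variance (c b) (d b) (s b) (t b))))"
proof (induction k arbitrary: s t)
  case 0
  interpret prob_space M by fact
  have "(\<integral>\<^sup>+\<omega>. ennreal (exp (\<Sum>b\<in>B. s b * ((x (int 0) \<omega> - y) \<bullet> b) + t b * ((x (int 0 - 1) \<omega> - y) \<bullet> b))) \<partial>M)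
    = (\<integral>\<^sup>+\<omega>. ennreal (exp (\<Sum>b\<in>B. s b * m (Suc 0) b + t b * m 0 b)) \<partial>M)"
    using m(1) m(2) by (intro nn_integral_cong) (simp add: init)
  also have "\<dots> = ennreal (exp (\<Sum>b\<in>B. s b * m (Suc 0) b + t b * m 0 b))"
    by (simp add: emeasure_space_1)
  also have "\<dots> \<le> ennreal (exp ((\<Sum>b\<in>B. s b * m (Suc 0) b + t b * m 0 b)
          + \<alpha>\<^sup>2 * \<sigma>\<^sup>2 / 2 * (\<Sum>b\<in>B. ar2_pair_variance (c b) (d b) (s b) (t b))))"
    using ar2_pair_variance_nonneg[OF stable] by (intro ennreal_leI) (auto intro!: mult_nonneg_nonneg sum_nonneg)
  finally show ?case .
next
  case (Suc k)
  interpret prob_space M by fact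
  define s' t' where "s' b = c b * s b + t b" and "t' b = d b * s b" for b
  define a where "a = (- \<alpha>) *\<^sub>R (\<Sum>b\<in>B. s b *\<^sub>R b)"
  define X where "X \<omega> = ennreal (exp (a \<bullet> w (k + 1) \<omega>))" for \<omega>
  define Y where "Y \<omega> = ennreal (exp (\<Sum>b\<in>B. s' b * ((x (int k) \<omega> - y) \<bullet> b) + t' b * ((x (int k - 1) \<omega> - y) \<bullet> b)))" for \<omega>
  have split: "ennreal (exp (\<Sum>b\<in>B. s b * ((x (int (Suc k)) \<omega> - y) \<bullet> b) + t b * ((x (int (Suc k) - 1) \<omega> - y) \<bullet> b)))
      = X \<omega> * Y \<omega>" if "\<omega> \<in> space M" for \<omega>
  proof -
    have "(\<Sum>b\<in>B. s b * ((x (int k + 1) \<omega> - y) \<bullet> b) + t b * ((x (int k) \<omega> - y) \<bullet> b))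
      = a \<bullet> w (k + 1) \<omega> + (\<Sum>b\<in>B. s' b * ((x (int k) \<omega> - y) \<bullet> b) + t' b * ((x (int k - 1) \<omega> - y) \<bullet> b))"
      unfolding a_def inner_scaleR_left inner_sum_left sum_distrib_left sum.distrib[symmetric]
      by (intro sum.cong refl, simp only: rec[OF that])
        (simp add: s'_def t'_def inner_commute algebra_simps)
    then show ?thesis
      by (simp add: X_def Y_def exp_add ennreal_mult add.commute)
  qed
  have w_dist: "distributed M lborel (w (k + 1)) (\<lambda>v. ennreal (isotropic_normal_density \<sigma> v))"
    and w_indep: "indep_set {w (k + 1) -` B \<inter> space M | B. B \<in> sets borel} (history M x k)"
    using noise by (auto simp: gaussian_noise_def)
  \<comment> \<open>The new noise lives on \<open>F\<close>, the two previous iterates on the past \<open>H\<close>.\<close>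
  define F where "F = vimage_algebra (space M) (w (k + 1)) (borel :: (real^'n) measure)"
  define H where "H = sigma (space M) (\<Union>j\<in>{0..int k}. {x j -` B \<inter> space M | B. B \<in> sets borel})"
  have "sets F = {w (k + 1) -` B \<inter> space M | B. B \<in> sets borel}"
    unfolding F_def by (rule sets_vimage_algebra2) simp
  moreover have sp_H: "space H = space M" by (simp add: H_def space_measure_of_conv)
  moreover have "sets H = history M x k"
    unfolding H_def history_def by (rule sets_measure_of) auto
  ultimately have FH: "indep_set (sets F) (sets H)" using w_indep by simp
  have xk [measurable]: "x (int k) \<in> H \<rightarrow>\<^sub>M borel"
    unfolding H_def by (rule history_measurable) simp
  have xk1 [measurable]: "x (int k - 1) \<in> H \<rightarrow>\<^sub>M borel"
  \<comment> \<open>The iterate \<open>x (-1)\<close> is not among the generators of the history, but it is constant.\<close>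
  proof (cases "k = 0")
    case True
    have "x (int k - 1) \<in> H \<rightarrow>\<^sub>M borel \<longleftrightarrow> (\<lambda>_. xm1) \<in> H \<rightarrow>\<^sub>M borel"
      by (rule measurable_cong) (simp add: True sp_H init)
    then show ?thesis by simp
  next
    case False
    then show ?thesis
      unfolding H_def by (intro history_measurable) simp
  qed
  have "indep_var borel X borel Y"
  proof (rule indep_var_of_indep_algebras[OF FH])
    have [measurable]: "w (k + 1) \<in> F \<rightarrow>\<^sub>M borel"
      unfolding F_def by (rule measurable_vimage_algebra1) simp
    show "X \<in> F \<rightarrow>\<^sub>M borel" unfolding X_def[abs_def] by measurable
    show "Y \<in> H \<rightarrow>\<^sub>M borel" unfolding Y_def[abs_def] by measurable
  qed (simp_all add: F_def sp_H)
  then have "(\<integral>\<^sup>+\<omega>. X \<omega> * Y \<omega> \<partial>M) = (\<integral>\<^sup>+\<omega>. X \<omega> \<partial>M) * (\<integral>\<^sup>+\<omega>. Y \<omega> \<partial>M)"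
    by (rule indep_var_nn_integral_mult)
  also have "(\<integral>\<^sup>+\<omega>. X \<omega> \<partial>M) = ennreal (exp (\<sigma>\<^sup>2 * (norm a)\<^sup>2 / 2))"
    unfolding X_def isotropic_normal_exponential_moment[OF \<sigma>, symmetric]
    by (rule distributed_nn_integral[OF w_dist, symmetric]) simp
  also have "(norm a)\<^sup>2 = \<alpha>\<^sup>2 * (\<Sum>b\<in>B. (s b)\<^sup>2)"
    by (simp add: a_def power_mult_distrib orthonormal_norm_sum[OF B])
  also have "(\<integral>\<^sup>+\<omega>. Y \<omega> \<partial>M) \<le> ennreal (exp ((\<Sum>b\<in>B. s' b * m (Suc k) b + t' b * m k b)
          + \<alpha>\<^sup>2 * \<sigma>\<^sup>2 / 2 * (\<Sum>b\<in>B. ar2_pair_variance (c b) (d b) (s' b) (t' b))))"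
    unfolding Y_def by (rule Suc.IH)
  finally have "(\<integral>\<^sup>+\<omega>. X \<omega> * Y \<omega> \<partial>M) \<le> ennreal (exp (\<sigma>\<^sup>2 * (\<alpha>\<^sup>2 * (\<Sum>b\<in>B. (s b)\<^sup>2)) / 2)) *
     ennreal (exp ((\<Sum>b\<in>B. s' b * m (Suc k) b + t' b * m k b)
          + \<alpha>\<^sup>2 * \<sigma>\<^sup>2 / 2 * (\<Sum>b\<in>B. ar2_pair_variance (c b) (d b) (s' b) (t' b))))"
    by (simp add: mult_left_mono)
  also have "\<dots> = ennreal (exp ((\<Sum>b\<in>B. s b * m (Suc (Suc k)) b + t b * m (Suc k) b)
          + \<alpha>\<^sup>2 * \<sigma>\<^sup>2 / 2 * (\<Sum>b\<in>B. ar2_pair_variance (c b) (d b) (s b) (t b))))"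
  proof -
    have "(\<Sum>b\<in>B. ar2_pair_variance (c b) (d b) (s b) (t b)) = (\<Sum>b\<in>B. (s b)\<^sup>2) + (\<Sum>b\<in>B. ar2_pair_variance (c b) (d b) (s' b) (t' b))"
      unfolding sum.distrib[symmetric] s'_def t'_def
      by (intro sum.cong refl ar2_pair_variance_step stable)
    moreover have "(\<Sum>b\<in>B. s b * m (Suc (Suc k)) b + t b * m (Suc k) b) = (\<Sum>b\<in>B. s' b * m (Suc k) b + t' b * m k b)"
      by (simp add: m(3) s'_def t'_def algebra_simps)
    ultimately show ?thesis
      by (simp add: ennreal_mult[symmetric] exp_add[symmetric] algebra_simps)
  qed
  finally show ?case
    using split by (simp cong: nn_integral_cong)
qed

lemma noisy_gmm_measurable:
  fixes Q :: "real^'n^'n"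
  assumes sym: "transpose Q = Q"
    and gmm: "noisy_gmm M (quad_fun Q p r) \<alpha> \<beta> \<gamma> x0 xm1 w x"
    and w: "\<And>k. w (Suc k) \<in> borel_measurable M"
  shows "x (int k) \<in> borel_measurable M"
proof -
  have "x (int k) \<in> borel_measurable M \<and> x (int k - 1) \<in> borel_measurable M"
  proof (induction k)
    case 0
    have "x 0 \<in> borel_measurable M \<longleftrightarrow> (\<lambda>_. x0) \<in> borel_measurable M"
      "x (- 1) \<in> borel_measurable M \<longleftrightarrow> (\<lambda>_. xm1) \<in> borel_measurable M"
      by (rule measurable_cong; use gmm in \<open>simp add: noisy_gmm_def\<close>)+
    then show ?case by simp
  next
    case (Suc k)
    note Suc.IH[THEN conjunct1, measurable] Suc.IH[THEN conjunct2, measurable] w[measurable]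
    have [measurable]: "(\<lambda>v. Q *v v) \<in> borel_measurable borel"
      by (intro borel_measurable_continuous_onI matrix_vector_mult_linear_continuous_on)
    have "x (int k + 1) \<in> borel_measurable M \<longleftrightarrow>
      (\<lambda>\<omega>. (1 + \<beta>) *\<^sub>R x (int k) \<omega> - \<beta> *\<^sub>R x (int k - 1) \<omega>
         - \<alpha> *\<^sub>R ((Q *v ((1 + \<gamma>) *\<^sub>R x (int k) \<omega> - \<gamma> *\<^sub>R x (int k - 1) \<omega>) + p) + w (Suc k) \<omega>)) \<in> borel_measurable M"
      using gmm by (intro measurable_cong) (simp add: noisy_gmm_def grad_quad_fun[OF sym] Let_def)
    also have "\<dots>" by measurable
    finally show ?case using Suc.IH by (simp add: add.commute)
  qed
  then show ?thesis by simp
qed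

lemma noisy_gmm_coordinate_recursion:
  fixes Q :: "real^'n^'n"
  assumes sym: "transpose Q = Q" and p: "p = - (Q *v xstar)" and b: "Q *v b = l *\<^sub>R b"
    and gmm: "noisy_gmm M (quad_fun Q p r) \<alpha> \<beta> \<gamma> x0 xm1 w x" and \<omega>: "\<omega> \<in> space M"
  shows "(x (int k + 1) \<omega> - xstar) \<bullet> b = gmm_c \<alpha> \<beta> \<gamma> l * ((x (int k) \<omega> - xstar) \<bullet> b)
      + gmm_d \<alpha> \<beta> \<gamma> l * ((x (int k - 1) \<omega> - xstar) \<bullet> b) - \<alpha> * (w (k + 1) \<omega> \<bullet> b)"
proof -
  have Qb: "(Q *v v) \<bullet> b = l * (v \<bullet> b)" for v
    by (simp add: symmetric_matrix_self_adjoint[OF sym] b)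
  have step: "x (int k + 1) \<omega> = (1 + \<beta>) *\<^sub>R x (int k) \<omega> - \<beta> *\<^sub>R x (int k - 1) \<omega>
       - \<alpha> *\<^sub>R ((Q *v ((1 + \<gamma>) *\<^sub>R x (int k) \<omega> - \<gamma> *\<^sub>R x (int k - 1) \<omega>) + p) + w (k + 1) \<omega>)"
    using gmm \<omega> by (simp add: noisy_gmm_def grad_quad_fun[OF sym] Let_def)
  show ?thesis
    unfolding inner_diff_left step
    by (simp add: p inner_diff_left inner_add_left Qb gmm_c_def gmm_d_def algebra_simps)
qed

section \<open>The stationary law\<close>

text \<open>
A Fatou property of weak convergence: the integrals of truncations converge, and the truncations
increase to \<open>h\<close>.
\<close>

lemma weak_limit_nn_integral_le:
  fixes h :: "'b::{topological_space, second_countable_topology} \<Rightarrow> real"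
  assumes conv: "converges_weakly \<mu> \<nu>"
    and \<mu>: "\<And>k. prob_space (\<mu> k)" "\<And>k. sets (\<mu> k) = sets borel"
    and \<nu>: "prob_space \<nu>" "sets \<nu> = sets borel"
    and h: "continuous_on UNIV h" "\<And>y. h y \<ge> 0"
    and bound: "\<And>k. (\<integral>\<^sup>+y. ennreal (h y) \<partial>\<mu> k) \<le> ennreal (K k)" "\<And>k. K k \<ge> 0"
    and lim: "K \<longlonglongrightarrow> K0"
  shows "(\<integral>\<^sup>+y. ennreal (h y) \<partial>\<nu>) \<le> ennreal K0"
proof -
  \<comment> \<open>Truncations of \<open>h\<close> are bounded and continuous, hence test functions for weak convergence.\<close>
  define g where "g n y = min (h y) (real n)" for n y
  have g_cont: "continuous_on UNIV (g n)" for n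
    unfolding g_def by (intro continuous_intros h)
  then have g_borel: "g n \<in> borel_measurable borel" for n
    by (rule borel_measurable_continuous_onI)
  have g_bounds: "0 \<le> g n y" "g n y \<le> h y" "g n y \<le> real n" for n y
    using h(2) by (auto simp: g_def)
  have nn: "(\<integral>\<^sup>+y. ennreal (g n y) \<partial>P) = ennreal (integral\<^sup>L P (g n))"
    if "prob_space P" "sets P = sets borel" for P n
  proof (rule nn_integral_eq_integral)
    interpret prob_space P by fact
    show "integrable P (g n)"
      using that(2) g_borel g_bounds
      by (intro integrable_const_bound[where B = "real n"]) (auto cong: measurable_cong_sets)
  qed (use g_bounds in auto)
  have trunc: "(\<integral>\<^sup>+y. ennreal (g n y) \<partial>\<nu>) \<le> ennreal K0" for n
  proof -
    have "bounded (range (g n))"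
      using g_bounds by (intro boundedI[where B = "real n"]) auto
    then have "(\<lambda>k. integral\<^sup>L (\<mu> k) (g n)) \<longlonglongrightarrow> integral\<^sup>L \<nu> (g n)"
      using conv g_cont unfolding converges_weakly_def by blast
    moreover have "integral\<^sup>L (\<mu> k) (g n) \<le> K k" for k
    proof -
      have "ennreal (integral\<^sup>L (\<mu> k) (g n)) \<le> (\<integral>\<^sup>+y. ennreal (h y) \<partial>\<mu> k)"
        unfolding nn[OF \<mu>, symmetric] using g_bounds by (intro nn_integral_mono) (simp add: ennreal_leI)
      also have "\<dots> \<le> ennreal (K k)" by (rule bound)
      finally show ?thesis using bound(2) by (simp add: ennreal_le_iff)
    qed
    ultimately have "integral\<^sup>L \<nu> (g n) \<le> K0"
      using lim by (intro LIMSEQ_le) auto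
    then show ?thesis unfolding nn[OF \<nu>] by (rule ennreal_leI)
  qed
  have "(SUP n. ennreal (g n y)) = ennreal (h y)" for y
  proof (rule antisym)
    show "(SUP n. ennreal (g n y)) \<le> ennreal (h y)"
      by (intro SUP_least ennreal_leI g_bounds)
    have "h y \<le> real (nat \<lceil>h y\<rceil>)" by linarith
    then show "ennreal (h y) \<le> (SUP n. ennreal (g n y))"
      by (intro SUP_upper2[of "nat \<lceil>h y\<rceil>"]) (auto simp: g_def)
  qed
  then have "(\<integral>\<^sup>+y. ennreal (h y) \<partial>\<nu>) = (\<integral>\<^sup>+y. (SUP n. ennreal (g n y)) \<partial>\<nu>)"
    by simp
  also have "\<dots> = (SUP n. \<integral>\<^sup>+y. ennreal (g n y) \<partial>\<nu>)"
  proof (rule nn_integral_monotone_convergence_SUP)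
    show "incseq (\<lambda>n y. ennreal (g n y))"
      by (auto simp: incseq_def le_fun_def g_def intro!: ennreal_leI)
    show "(\<lambda>y. ennreal (g n y)) \<in> borel_measurable \<nu>" for n
      using g_borel \<nu>(2) by (auto cong: measurable_cong_sets)
  qed
  also have "\<dots> \<le> ennreal K0"
    by (rule SUP_least) (rule trunc)
  finally show ?thesis .
qed

text \<open>
In the limit the means disappear and only the variances remain; the coefficients of the second
newest iterate are set to zero.
\<close>

lemma stationary_linear_exponential_moment_le:
  fixes Q :: "real^'n^'n"
  assumes sym: "transpose Q = Q" and p: "p = - (Q *v xstar)"
    and B: "finite B" "orthonormal_set B" "\<And>b. b \<in> B \<Longrightarrow> Q *v b = l b *\<^sub>R b"
    and stable: "\<And>b. b \<in> B \<Longrightarrow> schur_stable (gmm_c \<alpha> \<beta> \<gamma> (l b)) (gmm_d \<alpha> \<beta> \<gamma> (l b))"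
    and \<sigma>: "0 < \<sigma>" and M: "prob_space M"
    and gmm: "noisy_gmm M (quad_fun Q p r) \<alpha> \<beta> \<gamma> x0 xm1 w x"
    and noise: "gaussian_noise M \<sigma> w x"
    and stat: "stationary_law M x \<nu>"
  shows "(\<integral>\<^sup>+y. ennreal (exp (\<Sum>b\<in>B. s b * ((y - xstar) \<bullet> b))) \<partial>\<nu>)
    \<le> ennreal (exp (1/2 * (\<Sum>b\<in>B. \<alpha>\<^sup>2 * \<sigma>\<^sup>2
          * ar2_variance (gmm_c \<alpha> \<beta> \<gamma> (l b)) (gmm_d \<alpha> \<beta> \<gamma> (l b)) * (s b)\<^sup>2)))"
proof -
  interpret prob_space M by fact
  define c d where "c b = gmm_c \<alpha> \<beta> \<gamma> (l b)" and "d b = gmm_d \<alpha> \<beta> \<gamma> (l b)" for b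
  note stable' = stable[folded c_def d_def]
  \<comment> \<open>\<open>m\<close> is the trajectory without noise, shifted by one so that \<open>m 0\<close> belongs to the index \<open>-1\<close>;
    \<open>pair b k\<close> holds two consecutive values, the newer one first.\<close>
  define pair where "pair b k = ((\<lambda>(u, v). (c b * u + d b * v, u)) ^^ k) ((x0 - xstar) \<bullet> b, (xm1 - xstar) \<bullet> b)"
    for b :: "real^'n" and k :: nat
  define m where "m k b = snd (pair b k)" for k b
  have fst_pair: "fst (pair b k) = m (Suc k) b" for b k
    by (simp add: m_def pair_def case_prod_unfold)
  have m: "m 0 b = (xm1 - xstar) \<bullet> b" "m 1 b = (x0 - xstar) \<bullet> b"
    "m (Suc (Suc k)) b = c b * m (Suc k) b + d b * m k b" for k b
  proof -
    show "m 0 b = (xm1 - xstar) \<bullet> b" "m 1 b = (x0 - xstar) \<bullet> b"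
      by (simp_all add: m_def pair_def)
    have "m (Suc (Suc k)) b = fst (pair b (Suc k))" by (simp add: fst_pair)
    also have "\<dots> = c b * fst (pair b k) + d b * snd (pair b k)"
      by (simp add: pair_def case_prod_unfold)
    finally show "m (Suc (Suc k)) b = c b * m (Suc k) b + d b * m k b"
      by (simp add: fst_pair m_def[symmetric])
  qed
  have "distributed M lborel (w (k + 1)) (\<lambda>v. ennreal (isotropic_normal_density \<sigma> v))" for k
    using noise unfolding gaussian_noise_def by blast
  from distributed_measurable[OF this] have "w (Suc k) \<in> borel_measurable M" for k
    by simp
  then have meas: "x (int k) \<in> borel_measurable M" for k
    by (rule noisy_gmm_measurable[OF sym gmm])
  define K where "K k = exp ((\<Sum>b\<in>B. s b * m (Suc k) b)
          + \<alpha>\<^sup>2 * \<sigma>\<^sup>2 / 2 * (\<Sum>b\<in>B. ar2_pair_variance (c b) (d b) (s b) 0))" for k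
  have finite_horizon: "(\<integral>\<^sup>+y. ennreal (exp (\<Sum>b\<in>B. s b * ((y - xstar) \<bullet> b))) \<partial>distr M borel (x (int k)))
      \<le> ennreal (K k)" for k
  proof -
    have "(\<integral>\<^sup>+\<omega>. ennreal (exp (\<Sum>b\<in>B. s b * ((x (int k) \<omega> - xstar) \<bullet> b) + 0 * ((x (int k - 1) \<omega> - xstar) \<bullet> b))) \<partial>M)
      \<le> ennreal (exp ((\<Sum>b\<in>B. s b * m (Suc k) b + 0 * m k b)
          + \<alpha>\<^sup>2 * \<sigma>\<^sup>2 / 2 * (\<Sum>b\<in>B. ar2_pair_variance (c b) (d b) (s b) 0)))"
      using gmm noisy_gmm_coordinate_recursion[OF sym p B(3) gmm] stable'
      by (intro linear_exponential_moment_le[OF M \<sigma> noise _ _ B(1,2) _ _ m])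
        (auto simp: noisy_gmm_def c_def d_def)
    then show ?thesis
      using meas by (simp add: nn_integral_distr K_def)
  qed
  have "(\<lambda>k. m k b) \<longlonglongrightarrow> 0" if "b \<in> B" for b
    by (rule noise_free_recursion_tendsto_0[OF stable'[OF that]]) (rule m)
  then have "K \<longlonglongrightarrow> exp ((\<Sum>b\<in>B. s b * 0) + \<alpha>\<^sup>2 * \<sigma>\<^sup>2 / 2 * (\<Sum>b\<in>B. ar2_pair_variance (c b) (d b) (s b) 0))"
    unfolding K_def by (intro tendsto_intros LIMSEQ_Suc)
  moreover have "\<alpha>\<^sup>2 * \<sigma>\<^sup>2 / 2 * (\<Sum>b\<in>B. ar2_pair_variance (c b) (d b) (s b) 0)
      = 1/2 * (\<Sum>b\<in>B. \<alpha>\<^sup>2 * \<sigma>\<^sup>2 * ar2_variance (c b) (d b) * (s b)\<^sup>2)"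
    by (simp add: ar2_pair_variance_def sum_distrib_left mult_ac)
  ultimately have lim: "K \<longlonglongrightarrow> exp (1/2 * (\<Sum>b\<in>B. \<alpha>\<^sup>2 * \<sigma>\<^sup>2 * ar2_variance (c b) (d b) * (s b)\<^sup>2))"
    by simp
  show ?thesis
    unfolding c_def[symmetric] d_def[symmetric]
  proof (rule weak_limit_nn_integral_le[OF _ _ _ _ _ _ _ finite_horizon _ lim])
    show "prob_space (distr M borel (x (int k)))" for k
      by (rule prob_space_distr) (rule meas)
    show "continuous_on UNIV (\<lambda>y. exp (\<Sum>b\<in>B. s b * ((y - xstar) \<bullet> b)))"
      by (intro continuous_intros)
  qed (use stat in \<open>auto simp: stationary_law_def K_def\<close>)
qed

section \<open>The entropic value at risk\<close>

text \<open>
With \<open>h = n / ln (1 / \<zeta>)\<close> the value is \<open>(sqrt (1 + 2 h) - 1) / h\<close>, and \<open>1 + 2 h < (1 + h)\<^sup>2\<close>.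
\<close>

lemma theta0_bounds:
  assumes "0 < \<zeta>" "\<zeta> < 1" "0 < n"
  shows "0 < theta0 \<zeta> n" "theta0 \<zeta> n < 1"
proof -
  define T where "T = ln (1 / \<zeta>)"
  have T: "T > 0" using assms by (simp add: T_def)
  define h where "h = real n / T"
  have h: "h > 0" using T assms by (simp add: h_def)
  have th: "theta0 \<zeta> n = (sqrt (1 + 2 * h) - 1) / h"
    using T assms by (simp add: theta0_def T_def[symmetric] h_def)
  show "0 < theta0 \<zeta> n" using h by (simp add: th)
  have "1 + 2 * h < (1 + h)\<^sup>2" using h by (simp add: power2_eq_square algebra_simps)
  then have "sqrt (1 + 2 * h) < 1 + h"
    using h by (intro real_less_lsqrt) auto
  then show "theta0 \<zeta> n < 1" using h by (simp add: th)
qed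

lemma gmm_u_eq_ar2_variance:
  "gmm_u \<alpha> \<beta> \<gamma> l = 1 / (l * \<alpha>\<^sup>2 * ar2_variance (gmm_c \<alpha> \<beta> \<gamma> l) (gmm_d \<alpha> \<beta> \<gamma> l))"
  by (simp add: gmm_u_def ar2_variance_def)

lemma ln_ennreal_le:
  assumes "e \<le> ennreal K" "0 < K"
  shows "ln_ennreal e \<le> ereal (ln K)"
proof (cases "e = 0")
  case False
  have top: "e \<noteq> \<top>" using assms(1) ennreal_less_top[of K] by (auto simp: top_unique)
  then have "0 < enn2real e" using False
    by (simp add: enn2real_positive_iff less_top zero_less_iff_neq_zero)
  moreover have "enn2real e \<le> K"
    using assms by (intro enn2real_leI) auto
  ultimately show ?thesis using False top by (simp add: ln_ennreal_def)
qed (simp add: ln_ennreal_def)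

lemma EVaR_le_of_exponential_moment:
  assumes "0 < \<theta>" "0 < K"
    and "(\<integral>\<^sup>+\<omega>. ennreal (exp (\<theta> / (2 * \<sigma>\<^sup>2) * Z \<omega>)) \<partial>N) \<le> ennreal K"
  shows "EVaR N \<sigma> \<zeta> Z \<le> ereal (2 * \<sigma>\<^sup>2 / \<theta> * (ln K + ln (1 / \<zeta>)))"
proof -
  have "EVaR N \<sigma> \<zeta> Z \<le> risk_cost N \<sigma> Z \<theta> + ereal (2 * \<sigma>\<^sup>2 / \<theta> * ln (1 / \<zeta>))"
    unfolding EVaR_def using assms(1) by (intro INF_lower) simp
  also have "risk_cost N \<sigma> Z \<theta> \<le> ereal (2 * \<sigma>\<^sup>2 / \<theta>) * ereal (ln K)"
    unfolding risk_cost_def using assms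
    by (intro ereal_mult_left_mono ln_ennreal_le) auto
  finally show ?thesis by (simp add: add_right_mono ring_distribs)
qed

theorem theorem1:
  fixes \<mu> L r \<alpha> \<beta> \<gamma> \<sigma> \<zeta> :: real
    and Q :: "real^'n^'n" and p xstar x0 xm1 :: "real^'n"
    and lam :: "nat \<Rightarrow> real"
    and f :: "real^'n \<Rightarrow> real"
    and M :: "'a measure" and w :: "nat \<Rightarrow> 'a \<Rightarrow> real^'n" and x :: "int \<Rightarrow> 'a \<Rightarrow> real^'n"
    and N :: "'b measure" and xinf :: "'b \<Rightarrow> real^'n"
  assumes "0 < \<mu>" and "\<mu> < L"
    and "transpose Q = Q"
    and "ordered_eigenvalues Q lam" and "lam 1 = \<mu>" and "lam CARD('n) = L"
    and "f = quad_fun Q p r"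
    and "is_arg_min f (\<lambda>_. True) xstar"
    and "(\<alpha>, \<beta>, \<gamma>) \<in> stable_set Q"
    and "0 < \<sigma>"
    and "prob_space M"
    and "noisy_gmm M f \<alpha> \<beta> \<gamma> x0 xm1 w x"
    and "gaussian_noise M \<sigma> w x"
    and "prob_space N" and "xinf \<in> borel_measurable N"
    and "stationary_law M x (distr N borel xinf)"
    and "0 < \<zeta>" and "\<zeta> < 1"
  shows "theta0 \<zeta> CARD('n) < 1
    \<and> EVaR N \<sigma> \<zeta> (\<lambda>\<omega>. f (xinf \<omega>) - f xstar)
        \<le> ereal (evar_bound CARD('n) \<sigma> \<zeta> (MIN i\<in>{1..CARD('n)}. gmm_u \<alpha> \<beta> \<gamma> (lam i)))"
proof
  note sym = \<open>transpose Q = Q\<close>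
  let ?n = "CARD('n)"
  have th: "0 < theta0 \<zeta> ?n" "theta0 \<zeta> ?n < 1"
    using theta0_bounds[of \<zeta> ?n] assms by auto
  show "theta0 \<zeta> ?n < 1" by fact
  define ubar where "ubar = (MIN i\<in>{1..?n}. gmm_u \<alpha> \<beta> \<gamma> (lam i))"
  \<comment> \<open>The direction of smallest \<open>gmm_u\<close> has the largest weighted variance; this exponent brings
    the weighted variance there to exactly \<open>theta0\<close>.\<close>
  define \<theta> where "\<theta> = 2 * ubar * theta0 \<zeta> ?n"
  have \<alpha>: "\<alpha> > 0" using assms by (simp add: stable_set_def)
  have p: "p = - (Q *v xstar)"
    using assms quad_fun_minimizer[OF sym] by blast
  have stable: "schur_stable (gmm_c \<alpha> \<beta> \<gamma> t) (gmm_d \<alpha> \<beta> \<gamma> t)" if "t \<in> lam ` {1..?n}" for t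
    using that ordered_eigenvalues_iff[OF \<open>ordered_eigenvalues Q lam\<close>, of t]
      stable_set_imp_schur_stable[OF sym] assms by blast
  have lam_pos: "t > 0" if t: "t \<in> lam ` {1..?n}" for t
  proof -
    obtain i where i: "i \<in> {1..?n}" "t = lam i" using t by blast
    then have "lam 1 \<le> lam i"
      using \<open>ordered_eigenvalues Q lam\<close> unfolding ordered_eigenvalues_def
      by (intro mono_onD[of "{1..?n}" lam]) auto
    then show ?thesis using i assms by simp
  qed
  have u_pos: "gmm_u \<alpha> \<beta> \<gamma> t > 0" if "t \<in> lam ` {1..?n}" for t
    using lam_pos[OF that] ar2_variance_pos[OF stable[OF that]] \<alpha>
    by (simp add: gmm_u_eq_ar2_variance)
  have ubar_le: "ubar \<le> gmm_u \<alpha> \<beta> \<gamma> t" if "t \<in> lam ` {1..?n}" for t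
    unfolding ubar_def using that by (intro Min_le) auto
  have "ubar \<in> (\<lambda>i. gmm_u \<alpha> \<beta> \<gamma> (lam i)) ` {1..?n}"
    unfolding ubar_def by (rule Min_in) auto
  then have ubar: "ubar > 0" using u_pos by auto
  then have \<theta>: "\<theta> > 0" using th by (simp add: \<theta>_def)
  obtain B l where B: "finite B" "orthonormal_set B" "span B = UNIV" "\<And>b. b \<in> B \<Longrightarrow> Q *v b = l b *\<^sub>R b"
    using symmetric_matrix_eigenbasis[OF sym] by metis
  have l: "l b \<in> lam ` {1..?n}" if "b \<in> B" for b
  proof -
    have "b \<noteq> 0" using B(2) that by (force simp: orthonormal_set_def)
    then show ?thesis
      using B(4)[OF that] ordered_eigenvalues_iff[OF \<open>ordered_eigenvalues Q lam\<close>] by blast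
  qed
  define v where "v b = \<alpha>\<^sup>2 * \<sigma>\<^sup>2 * ar2_variance (gmm_c \<alpha> \<beta> \<gamma> (l b)) (gmm_d \<alpha> \<beta> \<gamma> (l b))" for b
  define a where "a b = \<theta> / (2 * \<sigma>\<^sup>2) * l b" for b
  have av: "a b * v b \<le> theta0 \<zeta> ?n" if "b \<in> B" for b
  proof -
    have "a b * v b = theta0 \<zeta> ?n * (ubar / gmm_u \<alpha> \<beta> \<gamma> (l b))"
      using \<open>0 < \<sigma>\<close> by (simp add: a_def v_def \<theta>_def gmm_u_eq_ar2_variance)
    also have "\<dots> \<le> theta0 \<zeta> ?n * 1"
      using th ubar_le[OF l[OF that]] u_pos[OF l[OF that]] by (intro mult_left_mono) auto
    finally show ?thesis by simp
  qed
  let ?K = "(1 / sqrt (1 - theta0 \<zeta> ?n)) ^ ?n"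
  have "(\<integral>\<^sup>+\<omega>. ennreal (exp (1/2 * (\<Sum>b\<in>B. a b * ((xinf \<omega> - xstar) \<bullet> b)\<^sup>2))) \<partial>N)
      \<le> ennreal ((1 / sqrt (1 - theta0 \<zeta> ?n)) ^ card B)"
  proof (rule subgaussian_quadratic_exponential_moment[where v = v])
    fix s :: "real^'n \<Rightarrow> real"
    have "(\<integral>\<^sup>+y. ennreal (exp (\<Sum>b\<in>B. s b * ((y - xstar) \<bullet> b))) \<partial>distr N borel xinf)
      \<le> ennreal (exp (1/2 * (\<Sum>b\<in>B. v b * (s b)\<^sup>2)))"
      unfolding v_def using assms stable[OF l]
      by (intro stationary_linear_exponential_moment_le[OF sym p B(1,2,4), where M = M]) auto
    then show "(\<integral>\<^sup>+\<omega>. ennreal (exp (\<Sum>b\<in>B. s b * ((xinf \<omega> - xstar) \<bullet> b))) \<partial>N)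
      \<le> ennreal (exp (1/2 * (\<Sum>b\<in>B. v b * (s b)\<^sup>2)))"
      using \<open>xinf \<in> borel_measurable N\<close> by (simp add: nn_integral_distr)
    show "a b \<ge> 0" if "b \<in> B" for b
      using lam_pos[OF l[OF that]] \<theta> by (simp add: a_def)
  qed (use assms B av th in auto)
  also have "card B = ?n"
    using orthonormal_card[OF B(2,3)] by simp
  finally have moment: "(\<integral>\<^sup>+\<omega>. ennreal (exp (1/2 * (\<Sum>b\<in>B. a b * ((xinf \<omega> - xstar) \<bullet> b)\<^sup>2))) \<partial>N) \<le> ennreal ?K" .
  have "f (xinf \<omega>) - f xstar = 1/2 * (\<Sum>b\<in>B. l b * ((xinf \<omega> - xstar) \<bullet> b)\<^sup>2)" for \<omega>
    unfolding \<open>f = quad_fun Q p r\<close> by (rule quad_fun_excess[OF sym p B])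
  then have "\<theta> / (2 * \<sigma>\<^sup>2) * (f (xinf \<omega>) - f xstar) = 1/2 * (\<Sum>b\<in>B. a b * ((xinf \<omega> - xstar) \<bullet> b)\<^sup>2)" for \<omega>
    by (simp add: a_def sum_distrib_left mult_ac)
  with moment have "(\<integral>\<^sup>+\<omega>. ennreal (exp (\<theta> / (2 * \<sigma>\<^sup>2) * (f (xinf \<omega>) - f xstar))) \<partial>N) \<le> ennreal ?K"
    by (simp only:)
  then have "EVaR N \<sigma> \<zeta> (\<lambda>\<omega>. f (xinf \<omega>) - f xstar) \<le> ereal (2 * \<sigma>\<^sup>2 / \<theta> * (ln ?K + ln (1 / \<zeta>)))"
    using th by (intro EVaR_le_of_exponential_moment[OF \<theta>]) auto
  also have "2 * \<sigma>\<^sup>2 / \<theta> * (ln ?K + ln (1 / \<zeta>)) = evar_bound ?n \<sigma> \<zeta> ubar"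
  proof -
    have ln_K: "ln ?K = - real ?n * ln (1 - theta0 \<zeta> ?n) / 2"
      using th by (simp add: ln_realpow ln_div ln_sqrt)
    show ?thesis
      unfolding ln_K using th ubar by (simp add: evar_bound_def \<theta>_def field_simps)
  qed
  finally show "EVaR N \<sigma> \<zeta> (\<lambda>\<omega>. f (xinf \<omega>) - f xstar)
        \<le> ereal (evar_bound ?n \<sigma> \<zeta> (MIN i\<in>{1..?n}. gmm_u \<alpha> \<beta> \<gamma> (lam i)))"
    by (simp add: ubar_def)
qed

end
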